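(* Let $\sigma$ be an automorphism of an algebra $\mathcal{A}$ and let $(\mathcal{A},\mathfrak{H},D)$ be a Lipschitz-regular $\sigma$-spectral triple with $D$ invertible. Let $F=D\,|D|^{-1}$. Then $(\mathfrak{H},F)$ is a Fredholm module over $\mathcal{A}$. If moreover $(\mathcal{A},\mathfrak{H},D)$ is finitely summable, then so is $(\mathfrak{H},F)$.
   Context: Let $\sigma$ be an automorphism of the algebra $\mathcal{A}$. A (ungraded) $\sigma$-spectral triple $(\mathcal{A},\mathfrak{H},D)$ is given by an action of $\mathcal{A}$ by bounded operators on a Hilbert space $\mathfrak{H}$ and a self-adjoint operator $D$ on $\mathfrak{H}$ with compact resolvent such that $Da-\sigma(a)D$ is bounded for all $a\in\mathcal{A}$ (that is, $a$ preserves $\mathrm{Dom}(D)$ and $Da-\sigma(a)D$ extends to a bounded operator). It is graded if in addition there is a grading operator $\gamma=\gamma^*$, $\gamma^2=I$, commuting with the action of $\mathcal{A}$ and with $D\gamma=-\gamma D$. It is Lipschitz-regular if moreover $|D|a-\sigma(a)|D|$ is bounded for all $a\in\mathcal{A}$. A Fredholm module $(\mathfrak{H},F)$ over $\mathcal{A}$ is given by an action of $\mathcal{A}$ on $\mathfrak{H}$ and an operator $F=F^*$, $F^2=I$, such that $[F,a]$ is compact for all $a\in\mathcal{A}$ (in the graded case also $F\gamma=-\gamma F$, $\gamma$ commuting with $\mathcal{A}$). Finite summability: $(\mathcal{A},\mathfrak{H},D)$ is finitely summable if $D^{-1}\in\mathcal{L}^{n,\infty}$ for some $n\in\mathbb{N}$;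 $(\mathfrak{H},F)$ is finitely summable if there is $p\geq 1$ such that $[F,a]$ belongs to the Schatten class $\mathcal{L}^p$ for all $a\in\mathcal{A}$. Here, with $\mu_k(T)$ the singular values of $T$ in decreasing order, $\mathcal{L}^{n,\infty}$ is, for $n>1$, the ideal of compact operators with $\mu_k(T)=O(k^{-1/n})$ and, for $n=1$, that of compact operators with $\sum_{k\le N}\mu_k(T)=O(\log N)$. *)

theory Defs
  imports "HOL-Analysis.Analysis" "HOL-Library.Landau_Symbols"
begin

section \<open>Complex algebras and complex Hilbert spaces\<close>

class complex_vector = ab_group_add +
  fixes scaleC :: "complex \<Rightarrow> 'a \<Rightarrow> 'a"  (infixr "*\<^sub>C" 75)
  assumes scaleC_add_right: "c *\<^sub>C (x + y) = c *\<^sub>C x + c *\<^sub>C y"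
    and scaleC_add_left: "(c + d) *\<^sub>C x = c *\<^sub>C x + d *\<^sub>C x"
    and scaleC_scaleC: "c *\<^sub>C (d *\<^sub>C x) = (c * d) *\<^sub>C x"
    and scaleC_one: "1 *\<^sub>C x = x"

text \<open>Associative, not necessarily unital.\<close>

class complex_algebra = complex_vector + ring +
  assumes mult_scaleC_left: "(c *\<^sub>C x) * y = c *\<^sub>C (x * y)"
    and mult_scaleC_right: "x * (c *\<^sub>C y) = c *\<^sub>C (x * y)"

text \<open>The inner product is linear in its first argument. That \<open>cinner x x\<close> is a nonnegative real
  number, and zero only for \<open>x = 0\<close>, follows from \<open>cinner_commute\<close>, \<open>norm_eq_sqrt_cinner\<close> and the
  properties of the norm.\<close>

class complex_hilbert_space = complex_vector + banach +
  fixes cinner :: "'a \<Rightarrow> 'a \<Rightarrow> complex"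
  assumes scaleR_eq_scaleC: "r *\<^sub>R x = complex_of_real r *\<^sub>C x"
    and cinner_commute: "cinner x y = cnj (cinner y x)"
    and cinner_add_left: "cinner (x + y) z = cinner x z + cinner y z"
    and cinner_scaleC_left: "cinner (c *\<^sub>C x) y = c * cinner x y"
    and norm_eq_sqrt_cinner: "norm x = sqrt (Re (cinner x x))"

definition algebra_automorphism :: "('a::complex_algebra \<Rightarrow> 'a) \<Rightarrow> bool" where
  "algebra_automorphism \<sigma> \<longleftrightarrow>
     bij \<sigma> \<and> (\<forall>a b. \<sigma> (a + b) = \<sigma> a + \<sigma> b) \<and> (\<forall>c a. \<sigma> (c *\<^sub>C a) = c *\<^sub>C \<sigma> a) \<and>
     (\<forall>a b. \<sigma> (a * b) = \<sigma> a * \<sigma> b)"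

definition bounded_clinear ::
    "('h::complex_hilbert_space \<Rightarrow> 'h) \<Rightarrow> bool" where
  "bounded_clinear f \<longleftrightarrow> bounded_linear f \<and> (\<forall>c x. f (c *\<^sub>C x) = c *\<^sub>C f x)"

definition algebra_action ::
    "('a::complex_algebra \<Rightarrow> 'h::complex_hilbert_space \<Rightarrow> 'h) \<Rightarrow> bool" where
  "algebra_action \<pi> \<longleftrightarrow>
     (\<forall>a. bounded_clinear (\<pi> a)) \<and>
     (\<forall>a b x. \<pi> (a + b) x = \<pi> a x + \<pi> b x) \<and>
     (\<forall>c a x. \<pi> (c *\<^sub>C a) x = c *\<^sub>C \<pi> a x) \<and>
     (\<forall>a b x. \<pi> (a * b) x = \<pi> a (\<pi> b x))"


section \<open>Unbounded operators\<close>

text \<open>A partially defined operator is represented by its graph, so that \<open>Domain T\<close> is its domain,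
  equality of operators includes equality of domains, and \<open>S \<subseteq> T\<close> says that \<open>T\<close> extends \<open>S\<close>.\<close>

type_synonym 'h operator = "('h \<times> 'h) set"

definition linear_operator :: "'h::complex_hilbert_space operator \<Rightarrow> bool" where
  "linear_operator T \<longleftrightarrow>
     single_valued T \<and> (0, 0) \<in> T \<and>
     (\<forall>x y x' y'. (x, y) \<in> T \<longrightarrow> (x', y') \<in> T \<longrightarrow> (x + x', y + y') \<in> T) \<and>
     (\<forall>c x y. (x, y) \<in> T \<longrightarrow> (c *\<^sub>C x, c *\<^sub>C y) \<in> T)"

definition op_graph :: "('h \<Rightarrow> 'h) \<Rightarrow> 'h operator" where
  "op_graph f = {(x, f x) | x. True}"

text \<open>Relational composition \<open>T O S\<close> applies \<open>T\<close> first.\<close>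

definition op_comp :: "'h operator \<Rightarrow> 'h operator \<Rightarrow> 'h operator" where
  "op_comp S T = T O S"

definition op_diff :: "'h::complex_hilbert_space operator \<Rightarrow> 'h operator \<Rightarrow> 'h operator" where
  "op_diff S T = {(x, y - z) | x y z. (x, y) \<in> S \<and> (x, z) \<in> T}"

definition op_adjoint :: "'h::complex_hilbert_space operator \<Rightarrow> 'h operator" where
  "op_adjoint T = {(y, z). \<forall>(x, w) \<in> T. cinner w y = cinner x z}"

definition self_adjoint :: "'h::complex_hilbert_space operator \<Rightarrow> bool" where
  "self_adjoint T \<longleftrightarrow>
     linear_operator T \<and> closure (Domain T) = UNIV \<and> op_adjoint T = T"

definition positive_op :: "'h::complex_hilbert_space operator \<Rightarrow> bool" where
  "positive_op T \<longleftrightarrow> self_adjoint T \<and> (\<forall>(x, y) \<in> T. cinner y x \<in> \<real>\<^sub>\<ge>\<^sub>0)"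

text \<open>The absolute value \<open>\<bar>T\<bar>\<close> is the positive square root of \<open>T\<^sup>* T\<close>; it exists and is unique for
  every closed densely defined \<open>T\<close>.\<close>

definition op_abs :: "'h::complex_hilbert_space operator \<Rightarrow> 'h operator" where
  "op_abs T = (THE S. positive_op S \<and> op_comp S S = op_comp (op_adjoint T) T)"

definition bounded_op :: "'h::complex_hilbert_space operator \<Rightarrow> bool" where
  "bounded_op T \<longleftrightarrow> (\<exists>f. bounded_clinear f \<and> T = op_graph f)"

definition compact_op :: "'h::complex_hilbert_space operator \<Rightarrow> bool" where
  "compact_op T \<longleftrightarrow>
     (\<exists>f. bounded_clinear f \<and> T = op_graph f \<and> compact (closure (f ` ball 0 1)))"

text \<open>The inverse of an operator is the converse of its graph.\<close>

definition invertible_op :: "'h::complex_hilbert_space operator \<Rightarrow> bool" where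
  "invertible_op T \<longleftrightarrow> linear_operator T \<and> bounded_op (T\<inverse>)"

definition op_shift :: "'h::complex_hilbert_space operator \<Rightarrow> complex \<Rightarrow> 'h operator" where
  "op_shift T z = op_diff T (op_graph (\<lambda>x. z *\<^sub>C x))"

text \<open>It suffices to ask for one point of the resolvent set: by the resolvent identity all
  resolvents are compact as soon as one is.\<close>

definition compact_resolvent :: "'h::complex_hilbert_space operator \<Rightarrow> bool" where
  "compact_resolvent T \<longleftrightarrow>
     (\<exists>z. invertible_op (op_shift T z) \<and> compact_op ((op_shift T z)\<inverse>))"


section \<open>Singular values and operator ideals\<close>

definition eigenspace :: "'h::complex_hilbert_space operator \<Rightarrow> real \<Rightarrow> 'h set" where
  "eigenspace T s = {x. (x, complex_of_real s *\<^sub>C x) \<in> T}"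

text \<open>The singular values of a compact operator \<open>T\<close> are the nonzero eigenvalues of \<open>\<bar>T\<bar>\<close>, listed in
  decreasing order from index 0 on, each repeated according to its (complex) multiplicity, and
  followed by zeros if there are only finitely many. For compact \<open>T\<close> there is exactly one such
  sequence \<open>\<mu>\<close>.\<close>

definition singular_values :: "'h::complex_hilbert_space operator \<Rightarrow> (nat \<Rightarrow> real) \<Rightarrow> bool" where
  "singular_values T \<mu> \<longleftrightarrow>
     decseq \<mu> \<and> (\<forall>k. 0 \<le> \<mu> k) \<and>
     (\<forall>s>0. finite {k. \<mu> k = s} \<and>
        card {k. \<mu> k = s} = vector_space.dim (*\<^sub>C) (eigenspace (op_abs T) s))"

definition in_schatten :: "real \<Rightarrow> 'h::complex_hilbert_space operator \<Rightarrow> bool" where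
  "in_schatten p T \<longleftrightarrow>
     compact_op T \<and> (\<exists>\<mu>. singular_values T \<mu> \<and> summable (\<lambda>k. \<mu> k powr p))"

text \<open>The ideal \<open>\<L>\<^sup>n\<^sup>,\<^sup>\<infinity>\<close> for an integer \<open>n \<ge> 1\<close>.\<close>

definition in_weak_schatten :: "nat \<Rightarrow> 'h::complex_hilbert_space operator \<Rightarrow> bool" where
  "in_weak_schatten n T \<longleftrightarrow>
     compact_op T \<and>
     (\<exists>\<mu>. singular_values T \<mu> \<and>
        (if n = 1 then (\<lambda>N. \<Sum>k\<le>N. \<mu> k) \<in> O(\<lambda>N. ln (real N))
         else \<mu> \<in> O(\<lambda>k. real k powr (- 1 / real n))))"


section \<open>Twisted spectral triples and Fredholm modules\<close>

definition twisted_commutator ::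
    "('a \<Rightarrow> 'a) \<Rightarrow> ('a \<Rightarrow> 'h::complex_hilbert_space \<Rightarrow> 'h) \<Rightarrow> 'h operator \<Rightarrow> 'a \<Rightarrow> 'h operator" where
  "twisted_commutator \<sigma> \<pi> T a =
     op_diff (op_comp T (op_graph (\<pi> a))) (op_comp (op_graph (\<pi> (\<sigma> a))) T)"

definition bounded_twisted_commutators ::
    "('a \<Rightarrow> 'a) \<Rightarrow> ('a \<Rightarrow> 'h::complex_hilbert_space \<Rightarrow> 'h) \<Rightarrow> 'h operator \<Rightarrow> bool" where
  "bounded_twisted_commutators \<sigma> \<pi> T \<longleftrightarrow>
     (\<forall>a. \<pi> a ` Domain T \<subseteq> Domain T \<and>
        (\<exists>B. bounded_op B \<and> twisted_commutator \<sigma> \<pi> T a \<subseteq> B))"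

definition spectral_triple ::
    "('a::complex_algebra \<Rightarrow> 'a) \<Rightarrow> ('a \<Rightarrow> 'h::complex_hilbert_space \<Rightarrow> 'h) \<Rightarrow> 'h operator \<Rightarrow> bool" where
  "spectral_triple \<sigma> \<pi> D \<longleftrightarrow>
     algebra_action \<pi> \<and> self_adjoint D \<and> compact_resolvent D \<and>
     bounded_twisted_commutators \<sigma> \<pi> D"

definition lipschitz_regular ::
    "('a::complex_algebra \<Rightarrow> 'a) \<Rightarrow> ('a \<Rightarrow> 'h::complex_hilbert_space \<Rightarrow> 'h) \<Rightarrow> 'h operator \<Rightarrow> bool" where
  "lipschitz_regular \<sigma> \<pi> D \<longleftrightarrow> bounded_twisted_commutators \<sigma> \<pi> (op_abs D)"

definition finitely_summable_triple :: "'h::complex_hilbert_space operator \<Rightarrow> bool" where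
  "finitely_summable_triple D \<longleftrightarrow> (\<exists>n\<ge>1. in_weak_schatten n (D\<inverse>))"

definition fredholm_module ::
    "('a::complex_algebra \<Rightarrow> 'h::complex_hilbert_space \<Rightarrow> 'h) \<Rightarrow> 'h operator \<Rightarrow> bool" where
  "fredholm_module \<pi> F \<longleftrightarrow>
     algebra_action \<pi> \<and> bounded_op F \<and> op_adjoint F = F \<and> op_comp F F = Id \<and>
     (\<forall>a. compact_op (twisted_commutator id \<pi> F a))"

definition finitely_summable_module ::
    "('a::complex_algebra \<Rightarrow> 'h::complex_hilbert_space \<Rightarrow> 'h) \<Rightarrow> 'h operator \<Rightarrow> bool" where
  "finitely_summable_module \<pi> F \<longleftrightarrow>
     (\<exists>p\<ge>1. \<forall>a. in_schatten p (twisted_commutator id \<pi> F a))"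

text \<open>\<open>\<gamma>\<close> grades the action \<open>\<pi>\<close> and the operator \<open>T\<close>, where \<open>T\<close> is \<open>D\<close> or \<open>F\<close>. The equation
  \<open>T \<gamma> = - \<gamma> T\<close> is one between unbounded operators, so it includes that \<open>\<gamma>\<close> preserves the domain of
  \<open>T\<close>.\<close>

definition grading ::
    "('a::complex_algebra \<Rightarrow> 'h::complex_hilbert_space \<Rightarrow> 'h) \<Rightarrow> 'h operator \<Rightarrow> ('h \<Rightarrow> 'h) \<Rightarrow> bool" where
  "grading \<pi> T \<gamma> \<longleftrightarrow>
     bounded_clinear \<gamma> \<and> op_adjoint (op_graph \<gamma>) = op_graph \<gamma> \<and> \<gamma> \<circ> \<gamma> = id \<and>
     (\<forall>a. \<gamma> \<circ> \<pi> a = \<pi> a \<circ> \<gamma>) \<and>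
     op_comp T (op_graph \<gamma>) = op_comp (op_graph (\<lambda>x. - \<gamma> x)) T"

end

theory Submission
  imports Defs
begin

text \<open>
  Put \<open>T = D\<inverse>\<close>, a compact injective symmetric operator. Maximising \<open>\<parallel>T x\<parallel>\<close> over the unit vectors
  orthogonal to the maximisers already found gives orthonormal \<open>e\<^sub>k\<close> and \<open>\<mu>\<^sub>k \<rightarrow> 0\<close> with
  \<open>\<bar>T\<bar> x = \<Sum>\<^sub>k \<mu>\<^sub>k \<langle>x, e\<^sub>k\<rangle> e\<^sub>k\<close>; this needs no adjoint of \<open>T\<close>, so it applies to every compact operator.
  Uniqueness of positive square roots gives \<open>\<bar>D\<bar> = \<bar>T\<bar>\<inverse>\<close>, and \<open>F\<close> is the operator with
  \<open>F e\<^sub>k = \<mu>\<^sub>k\<inverse> T e\<^sub>k\<close>.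

  If \<open>\<delta>\<close> and \<open>\<delta>'\<close> are the bounded extensions of \<open>D a - \<sigma>(a) D\<close> and \<open>\<bar>D\<bar> a - \<sigma>(a) \<bar>D\<bar>\<close>, then
  \<open>[F, \<sigma>(a)] = (\<delta> - F \<delta>') \<bar>D\<bar>\<inverse>\<close>. Hence \<open>\<parallel>[F, \<sigma>(a)] x\<parallel> \<le> M \<parallel>T x\<parallel>\<close>, so the commutator is compact and, by a
  min-max argument, its singular values are at most \<open>M \<mu>\<^sub>k\<close>. Since \<open>\<sigma>\<close> is onto, this covers all
  commutators. A grading anticommutes with \<open>T\<close>, hence commutes with \<open>T\<^sup>2\<close> and with \<open>\<bar>T\<bar>\<close>.
\<close>

section \<open>Complex inner products\<close>

global_interpretation cvec: vector_space "scaleC :: complex \<Rightarrow> 'a::complex_vector \<Rightarrow> 'a"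
  by unfold_locales (simp_all add: scaleC_add_right scaleC_add_left scaleC_scaleC scaleC_one)

lemma cinner_add_right: "cinner x (y + z) = cinner x y + cinner (x::'h::complex_hilbert_space) z"
  by (metis cinner_add_left cinner_commute complex_cnj_add)

lemma cinner_scaleC_right: "cinner x (c *\<^sub>C y) = cnj c * cinner (x::'h::complex_hilbert_space) y"
  by (metis cinner_commute cinner_scaleC_left complex_cnj_mult)

lemma cinner_zero_left [simp]: "cinner 0 (y::'h::complex_hilbert_space) = 0"
  using cinner_add_left[of 0 0 y] by simp

lemma cinner_zero_right [simp]: "cinner (x::'h::complex_hilbert_space) 0 = 0"
  using cinner_add_right[of x 0 0] by simp

lemma cinner_minus_left: "cinner (- x) y = - cinner (x::'h::complex_hilbert_space) y"
  using cinner_add_left[of x "- x" y] by (simp add: eq_neg_iff_add_eq_0 add.commute)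

lemma cinner_minus_right: "cinner x (- y) = - cinner (x::'h::complex_hilbert_space) y"
  using cinner_add_right[of x y "- y"] by (simp add: eq_neg_iff_add_eq_0 add.commute)

lemma cinner_diff_left: "cinner (x - y) z = cinner x z - cinner (y::'h::complex_hilbert_space) z"
  using cinner_add_left[of x "- y" z] by (simp add: cinner_minus_left)

lemma cinner_diff_right: "cinner x (y - z) = cinner x y - cinner (x::'h::complex_hilbert_space) z"
  using cinner_add_right[of x y "- z"] by (simp add: cinner_minus_right)

lemma cinner_sum_left: "cinner (\<Sum>i\<in>I. f i) (y::'h::complex_hilbert_space) = (\<Sum>i\<in>I. cinner (f i) y)"
  by (induction I rule: infinite_finite_induct) (simp_all add: cinner_add_left)

lemma cinner_sum_right: "cinner (x::'h::complex_hilbert_space) (\<Sum>i\<in>I. f i) = (\<Sum>i\<in>I. cinner x (f i))"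
  by (induction I rule: infinite_finite_induct) (simp_all add: cinner_add_right)

lemma cinner_self: "cinner x x = complex_of_real ((norm (x::'h::complex_hilbert_space))\<^sup>2)"
proof -
  have im: "Im (cinner x x) = 0"
    using cinner_commute[of x x] by (simp add: complex_eq_iff)
  have re: "Re (cinner x x) \<ge> 0"
    using norm_ge_zero[of x] unfolding norm_eq_sqrt_cinner by simp
  show ?thesis
    unfolding norm_eq_sqrt_cinner using im re by (simp add: complex_eq_iff)
qed

lemma norm_add_sq:
  "(norm (x + y))\<^sup>2 = (norm x)\<^sup>2 + 2 * Re (cinner x y) + (norm (y::'h::complex_hilbert_space))\<^sup>2"
proof -
  have c: "Re (cinner y x) = Re (cinner x y)"
    by (subst cinner_commute) simp
  have "complex_of_real ((norm (x + y))\<^sup>2) = cinner x x + cinner x y + cinner y x + cinner y y"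
    unfolding cinner_self[symmetric] by (simp add: cinner_add_left cinner_add_right)
  then have "Re (complex_of_real ((norm (x + y))\<^sup>2)) = Re (cinner x x + cinner x y + cinner y x + cinner y y)"
    by simp
  then show ?thesis using c by (simp add: cinner_self)
qed

lemma norm_diff_sq:
  "(norm (x - y))\<^sup>2 = (norm x)\<^sup>2 - 2 * Re (cinner x y) + (norm (y::'h::complex_hilbert_space))\<^sup>2"
  using norm_add_sq[of x "- y"] by (simp add: cinner_minus_right)

lemma parallelogram:
  "(norm (x + y))\<^sup>2 + (norm (x - y))\<^sup>2 = 2 * (norm x)\<^sup>2 + 2 * (norm (y::'h::complex_hilbert_space))\<^sup>2"
  by (simp add: norm_add_sq norm_diff_sq)

lemma norm_scaleC: "norm (c *\<^sub>C x) = cmod c * norm (x::'h::complex_hilbert_space)"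
proof -
  have "cinner (c *\<^sub>C x) (c *\<^sub>C x) = (c * cnj c) * cinner x x"
    by (simp add: cinner_scaleC_left cinner_scaleC_right)
  also have "\<dots> = complex_of_real ((cmod c * norm x)\<^sup>2)"
    by (simp only: cinner_self complex_norm_square[symmetric] power_mult_distrib of_real_mult of_real_power)
  finally have "(norm (c *\<^sub>C x))\<^sup>2 = (cmod c * norm x)\<^sup>2"
    unfolding cinner_self of_real_eq_iff .
  then show ?thesis by (simp add: power2_eq_iff_nonneg)
qed

lemma cinner_Cauchy_Schwarz: "cmod (cinner x y) \<le> norm x * norm (y::'h::complex_hilbert_space)"
proof (cases "y = 0")
  case False
  let ?c = "cinner x y / complex_of_real ((norm y)\<^sup>2)"
  have "cinner x (?c *\<^sub>C y) = complex_of_real ((cmod (cinner x y))\<^sup>2 / (norm y)\<^sup>2)"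
    using complex_norm_square[of "cinner x y"] by (simp add: cinner_scaleC_right mult_ac)
  moreover have "cmod ?c = cmod (cinner x y) / (norm y)\<^sup>2"
    by (simp add: norm_divide norm_power)
  then have "(norm (?c *\<^sub>C y))\<^sup>2 = (cmod (cinner x y))\<^sup>2 / (norm y)\<^sup>2"
    using False by (simp add: norm_scaleC power_mult_distrib power_divide power2_eq_square)
  ultimately have "0 \<le> (norm x)\<^sup>2 - (cmod (cinner x y))\<^sup>2 / (norm y)\<^sup>2"
    using norm_diff_sq[of x "?c *\<^sub>C y"] zero_le_power2[of "norm (x - ?c *\<^sub>C y)"] by simp
  then have "(cmod (cinner x y))\<^sup>2 \<le> (norm x * norm y)\<^sup>2"
    using False by (simp add: field_simps power_mult_distrib)
  then show ?thesis by (rule power2_le_imp_le) simp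
qed simp

lemma bounded_bilinear_cinner: "bounded_bilinear (cinner :: 'h::complex_hilbert_space \<Rightarrow> 'h \<Rightarrow> complex)"
proof
  show "\<exists>K. \<forall>a b. norm (cinner (a::'h) b) \<le> norm a * norm b * K"
    using cinner_Cauchy_Schwarz by (metis mult.right_neutral)
qed (simp_all add: cinner_add_left cinner_add_right cinner_scaleC_left cinner_scaleC_right
    scaleR_eq_scaleC scaleR_conv_of_real)

lemma bounded_bilinear_scaleC: "bounded_bilinear (scaleC :: complex \<Rightarrow> 'h::complex_hilbert_space \<Rightarrow> 'h)"
proof
  show "\<exists>K. \<forall>a b. norm (a *\<^sub>C (b::'h)) \<le> norm a * norm b * K"
    by (metis norm_scaleC mult.right_neutral order_refl)
qed (simp_all add: scaleC_add_right scaleC_add_left scaleR_eq_scaleC scaleC_scaleC scaleR_conv_of_real mult_ac)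

lemmas tendsto_cinner = bounded_bilinear.tendsto[OF bounded_bilinear_cinner]

lemma cinner_ext_right:
  assumes "\<And>x. cinner x y = cinner x (z::'h::complex_hilbert_space)"
  shows "y = z"
proof -
  have "cinner (y - z) (y - z) = 0"
    using assms[of "y - z"] by (simp add: cinner_diff_right)
  then show ?thesis by (simp add: cinner_self)
qed

text \<open>Polarisation: norms determine the real part of the inner product, and replacing
  \<open>y\<close> by \<open>\<i> *\<^sub>C y\<close> gives the imaginary part.\<close>

lemma cinner_isometry:
  fixes f :: "'h::complex_hilbert_space \<Rightarrow> 'h"
  assumes f: "bounded_clinear f" and iso: "\<And>x. norm (f x) = norm x"
  shows "cinner (f x) (f y) = cinner x y"
proof -
  have add: "f (x + y) = f x + f y" and sc: "f (c *\<^sub>C x) = c *\<^sub>C f x" for x y c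
    using f by (auto simp: bounded_clinear_def bounded_linear_def linear_add)
  have re: "Re (cinner (f x) (f y)) = Re (cinner x y)" for x y
    using norm_add_sq[of x y] norm_add_sq[of "f x" "f y"] by (simp add: iso flip: add)
  from re[of x y] re[of x "\<i> *\<^sub>C y"] show ?thesis
    by (simp add: complex_eq_iff sc cinner_scaleC_right)
qed

section \<open>Bounded complex-linear maps\<close>

lemma bounded_clinearD:
  assumes "bounded_clinear f"
  shows "bounded_linear f" "f (x + y) = f x + f y" "f (x - y) = f x - f y" "f 0 = 0"
    "f (- x) = - f x" "f (c *\<^sub>C x) = c *\<^sub>C f x" "f (\<Sum>i\<in>I. g i) = (\<Sum>i\<in>I. f (g i))"
  using assms unfolding bounded_clinear_def
  by (auto simp: bounded_linear_def linear_add linear_diff linear_0 linear_neg linear_sum)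

lemma bounded_clinearI:
  assumes "\<And>x y. f (x + y) = f x + f y" "\<And>c x. f (c *\<^sub>C x) = c *\<^sub>C f x" "\<And>x. norm (f x) \<le> K * norm x"
  shows "bounded_clinear (f :: 'h::complex_hilbert_space \<Rightarrow> 'h)"
  unfolding bounded_clinear_def
  by (intro conjI allI bounded_linear_intro[of f K]) (simp_all add: assms scaleR_eq_scaleC mult.commute)

lemma bounded_clinear_bound:
  assumes "bounded_clinear f"
  obtains K where "K > 0" "\<And>x. norm (f x) \<le> K * norm x"
  using bounded_linear.pos_bounded[OF bounded_clinearD(1)[OF assms]] by (metis mult.commute)

lemma bounded_clinear_compose:
  assumes "bounded_clinear f" "bounded_clinear g"
  shows "bounded_clinear (\<lambda>x. f (g x))"
  using assms bounded_linear_compose unfolding bounded_clinear_def by fastforce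

lemma bounded_clinear_diff:
  assumes "bounded_clinear f" "bounded_clinear g"
  shows "bounded_clinear (\<lambda>x. f x - g x)"
  using assms bounded_linear_sub unfolding bounded_clinear_def
  by (auto simp: cvec.scale_right_diff_distrib)

lemma bounded_clinear_tendsto:
  assumes "bounded_clinear f" "(g \<longlongrightarrow> l) G"
  shows "((\<lambda>x. f (g x)) \<longlongrightarrow> f l) G"
  using bounded_linear.tendsto[OF bounded_clinearD(1)] assms by blast

section \<open>Compact maps and their singular systems\<close>

text \<open>Sequential form of compactness, convenient for extracting subsequences. It uses the
  closed unit ball, whereas \<open>compact_op\<close> uses the open one.\<close>

definition compact_map :: "('h::complex_hilbert_space \<Rightarrow> 'h) \<Rightarrow> bool" where
  "compact_map A \<longleftrightarrow>
     (\<forall>x::nat \<Rightarrow> 'h. (\<forall>n. norm (x n) \<le> 1) \<longrightarrow> (\<exists>r. strict_mono r \<and> convergent (\<lambda>n. A (x (r n)))))"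

lemma compact_map_iff:
  assumes A: "bounded_clinear A"
  shows "compact_map A \<longleftrightarrow> compact (closure (A ` ball 0 1))"
proof
  assume cm: "compact_map A"
  show "compact (closure (A ` ball 0 1))"
    unfolding compact_def
  proof (intro allI impI)
    fix f :: "nat \<Rightarrow> 'a" assume f: "\<forall>n. f n \<in> closure (A ` ball 0 1)"
    \<comment> \<open>The points \<open>f n\<close> lie only in the closure of the image, so each is
      approximated by an actual image with an error tending to 0.\<close>
    have "\<exists>x. norm x \<le> 1 \<and> dist (A x) (f n) < inverse (real (Suc n))" for n
      using f[rule_format, of n] unfolding closure_approachable
      by (force dest!: spec[of _ "inverse (real (Suc n))"])
    then obtain x where x: "\<And>n. norm (x n) \<le> 1" "\<And>n. dist (A (x n)) (f n) < inverse (real (Suc n))"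
      by metis
    obtain r l where r: "strict_mono r" "(\<lambda>n. A (x (r n))) \<longlonglongrightarrow> l"
      using cm x(1) unfolding compact_map_def convergent_def by metis
    have "(\<lambda>n. dist (A (x n)) (f n)) \<longlonglongrightarrow> 0"
      by (rule tendsto_sandwich[OF _ _ tendsto_const LIMSEQ_inverse_real_of_nat])
        (auto intro!: always_eventually less_imp_le x(2) simp del: of_nat_Suc)
    then have "(\<lambda>n. A (x n) - f n) \<longlonglongrightarrow> 0"
      by (simp add: dist_norm tendsto_norm_zero_iff)
    from LIMSEQ_subseq_LIMSEQ[OF this r(1)] have "(\<lambda>n. A (x (r n)) - f (r n)) \<longlonglongrightarrow> 0"
      by (simp add: o_def)
    from tendsto_diff[OF r(2) this] have fl: "(\<lambda>n. f (r n)) \<longlonglongrightarrow> l"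
      by simp
    then have "l \<in> closure (A ` ball 0 1)"
      using f closed_sequentially[OF closed_closure, of "\<lambda>n. f (r n)"] by blast
    with r(1) fl show "\<exists>l\<in>closure (A ` ball 0 1). \<exists>r. strict_mono r \<and> (f \<circ> r) \<longlonglongrightarrow> l"
      by (auto simp: o_def)
  qed
next
  assume co: "compact (closure (A ` ball 0 1))"
  show "compact_map A"
    unfolding compact_map_def
  proof (intro allI impI)
    fix x :: "nat \<Rightarrow> 'a" assume x: "\<forall>n. norm (x n) \<le> 1"
    \<comment> \<open>Halving moves the closed unit ball into the open one.\<close>
    let ?y = "\<lambda>n. A ((1/2) *\<^sub>R x n)"
    have "?y n \<in> A ` ball 0 1" for n
      using x[rule_format, of n] by (intro imageI) simp
    then have "\<forall>n. ?y n \<in> closure (A ` ball 0 1)"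
      using closure_subset by blast
    then obtain l r where r: "strict_mono r" "(?y \<circ> r) \<longlonglongrightarrow> l"
      using spec[OF co[unfolded compact_def], of ?y] by auto
    have "A (x n) = 2 *\<^sub>R ?y n" for n
      using bounded_clinearD(1)[OF A] by (simp add: linear_scale bounded_linear.linear)
    then have "(\<lambda>n. A (x (r n))) \<longlonglongrightarrow> 2 *\<^sub>R l"
      using tendsto_scaleR[OF tendsto_const[of 2] r(2)] by (simp add: o_def)
    with r(1) show "\<exists>r. strict_mono r \<and> convergent (\<lambda>n. A (x (r n)))"
      unfolding convergent_def by blast
  qed
qed

lemma compact_op_iff: "compact_op (op_graph A) \<longleftrightarrow> bounded_clinear A \<and> compact_map A"
proof -
  have "op_graph A = op_graph f \<longleftrightarrow> A = f" for f :: "'a \<Rightarrow> 'a"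
    by (auto simp: op_graph_def set_eq_iff fun_eq_iff)
  then show ?thesis
    unfolding compact_op_def using compact_map_iff by auto
qed

text \<open>Domination carries the Cauchy property from the images under \<open>T\<close> to those
  under \<open>A\<close>, and completeness does the rest. It stands in for the ideal property of
  compact operators, so that no factorisation of \<open>A\<close> through \<open>T\<close> has to be
  constructed.\<close>

lemma compact_map_dominated:
  assumes T: "compact_map T" and A: "bounded_clinear A" "bounded_clinear T"
    and le: "\<And>x. norm (A x) \<le> M * norm (T x)"
  shows "compact_map A"
  unfolding compact_map_def
proof (intro allI impI)
  fix x :: "nat \<Rightarrow> 'a" assume "\<forall>n. norm (x n) \<le> 1"
  then obtain r where r: "strict_mono r" "convergent (\<lambda>n. T (x (r n)))"
    using T unfolding compact_map_def by blast
  have "Cauchy (\<lambda>n. A (x (r n)))"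
  proof (rule metric_CauchyI)
    fix \<epsilon> :: real assume "\<epsilon> > 0"
    then have "\<epsilon> / (\<bar>M\<bar> + 1) > 0" by simp
    then obtain N where N: "\<And>m n. m \<ge> N \<Longrightarrow> n \<ge> N \<Longrightarrow> dist (T (x (r m))) (T (x (r n))) < \<epsilon> / (\<bar>M\<bar> + 1)"
      using convergent_Cauchy[OF r(2)] unfolding Cauchy_def by metis
    have "dist (A (x (r m))) (A (x (r n))) < \<epsilon>" if "m \<ge> N" "n \<ge> N" for m n
    proof -
      have "dist (A (x (r m))) (A (x (r n))) \<le> M * dist (T (x (r m))) (T (x (r n)))"
        using le[of "x (r m) - x (r n)"] by (simp add: dist_norm bounded_clinearD[OF A(1)] bounded_clinearD[OF A(2)])
      also have "\<dots> \<le> (\<bar>M\<bar> + 1) * dist (T (x (r m))) (T (x (r n)))"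
        by (intro mult_right_mono) auto
      also have "\<dots> < (\<bar>M\<bar> + 1) * (\<epsilon> / (\<bar>M\<bar> + 1))"
        using N[OF that] by (intro mult_strict_left_mono) auto
      finally show ?thesis by simp
    qed
    then show "\<exists>N. \<forall>m\<ge>N. \<forall>n\<ge>N. dist (A (x (r m))) (A (x (r n))) < \<epsilon>"
      by blast
  qed
  with r(1) show "\<exists>r. strict_mono r \<and> convergent (\<lambda>n. A (x (r n)))"
    by (blast intro: Cauchy_convergent)
qed

text \<open>This is one stage of the construction of a singular system, with \<open>G\<close> the
  set of vectors already chosen. The alternative \<open>v = 0\<close> occurs when \<open>A\<close>
  vanishes on the orthogonal complement of \<open>G\<close>.\<close>

lemma compact_map_maximiser:
  assumes A: "bounded_clinear A" and cm: "compact_map A"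
  shows "\<exists>v. (norm v = 1 \<and> A v \<noteq> 0 \<or> v = 0) \<and> (\<forall>g\<in>G. cinner v g = 0) \<and>
           (\<forall>x. (\<forall>g\<in>G. cinner x g = 0) \<longrightarrow> norm (A x) \<le> norm (A v) * norm x)"
proof (cases "\<forall>x. (\<forall>g\<in>G. cinner x g = 0) \<longrightarrow> A x = 0")
  case True
  then show ?thesis by (intro exI[of _ 0]) auto
next
  case False
  define V where "V = {x. \<forall>g\<in>G. cinner x g = 0}"
  have V_sc: "c *\<^sub>C x \<in> V" if "x \<in> V" for c x
    using that by (simp add: V_def cinner_scaleC_left)
  have V_add: "x + y \<in> V" if "x \<in> V" "y \<in> V" for x y
    using that by (simp add: V_def cinner_add_left)
  obtain K where K: "\<And>x. norm (A x) \<le> K * norm x"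
    using bounded_clinear_bound[OF A] by blast
  define S where "S = (\<lambda>x. norm (A x)) ` {x \<in> V. norm x = 1}"
  define M where "M = Sup S"
  have bdd: "bdd_above S"
    unfolding S_def using K[THEN order_trans] by (intro bdd_aboveI2[of _ _ K]) auto
  have normalised: "norm (complex_of_real (inverse (norm x)) *\<^sub>C x) = 1"
      "norm (A (complex_of_real (inverse (norm x)) *\<^sub>C x)) = norm (A x) / norm x" if "x \<noteq> 0" for x
    using that by (simp_all add: norm_scaleC bounded_clinearD[OF A] norm_inverse divide_inverse)
  have le: "norm (A x) \<le> M * norm x" if "x \<in> V" for x
  proof (cases "x = 0")
    case False
    then have "norm (A x) / norm x \<in> S"
      unfolding S_def using normalised[OF False] V_sc[OF that] by (intro rev_image_eqI) auto
    then have "norm (A x) / norm x \<le> M"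
      unfolding M_def using bdd by (rule cSup_upper)
    then show ?thesis using False by (simp add: field_simps)
  qed (simp add: bounded_clinearD[OF A])
  obtain w where w: "w \<in> V" "A w \<noteq> 0" using False by (auto simp: V_def)
  then have "w \<noteq> 0" by (auto simp: bounded_clinearD[OF A])
  have "M * norm w > 0"
    using le[OF w(1)] w(2) by (meson norm_le_zero_iff not_le order_trans)
  then have M: "M > 0"
    using \<open>w \<noteq> 0\<close> by (simp add: zero_less_mult_iff)
  have "S \<noteq> {}"
    unfolding S_def using normalised[OF \<open>w \<noteq> 0\<close>] V_sc[OF w(1)] by blast
  have "\<exists>x\<in>V. norm x = 1 \<and> norm (A x) > M - inverse (real (Suc n))" for n
  proof -
    have "M - inverse (real (Suc n)) < Sup S" unfolding M_def by (simp del: of_nat_Suc)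
    then obtain t where "t \<in> S" "M - inverse (real (Suc n)) < t"
      using less_cSupE \<open>S \<noteq> {}\<close> by blast
    then show ?thesis unfolding S_def by blast
  qed
  then obtain x where x: "\<And>n. x n \<in> V" "\<And>n. norm (x n) = 1" "\<And>n. norm (A (x n)) > M - inverse (real (Suc n))"
    by metis
  obtain r y where r: "strict_mono r" "(\<lambda>n. A (x (r n))) \<longlonglongrightarrow> y"
    using cm[unfolded compact_map_def convergent_def, rule_format, of x] x(2) by auto
  have "(\<lambda>n. norm (A (x n))) \<longlonglongrightarrow> M"
  proof (rule tendsto_sandwich)
    show "(\<lambda>n. M - inverse (real (Suc n))) \<longlonglongrightarrow> M"
      using tendsto_diff[OF tendsto_const LIMSEQ_inverse_real_of_nat, of M] by simp
    show "\<forall>\<^sub>F n in sequentially. M - inverse (real (Suc n)) \<le> norm (A (x n))"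
      using x(3) by (intro always_eventually allI less_imp_le) auto
    show "\<forall>\<^sub>F n in sequentially. norm (A (x n)) \<le> M"
      using le[OF x(1)] x(2) by (intro always_eventually allI) simp
  qed auto
  from LIMSEQ_subseq_LIMSEQ[OF this r(1)] have lim: "(\<lambda>n. norm (A (x (r n)))) \<longlonglongrightarrow> M"
    by (simp add: o_def)
  then have My: "norm y = M"
    using tendsto_norm[OF r(2)] LIMSEQ_unique by blast
  define u where "u n = x (r n)" for n
  have u: "u n \<in> V" "norm (u n) = 1" for n using x by (auto simp: u_def)
  \<comment> \<open>By the parallelogram law in both spaces, a maximising sequence whose images converge is itself Cauchy.\<close>
  have key: "M\<^sup>2 * (norm (u n - u m))\<^sup>2 \<le> 2 * (M\<^sup>2 - (norm (A (u n)))\<^sup>2) + 2 * (M\<^sup>2 - (norm (A (u m)))\<^sup>2)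
      + (norm (A (u n) - A (u m)))\<^sup>2" for n m
  proof -
    have "(norm (A (u n) + A (u m)))\<^sup>2 \<le> (M * norm (u n + u m))\<^sup>2"
      using le[OF V_add[OF u(1) u(1)], of n m] by (intro power_mono) (simp_all add: bounded_clinearD[OF A])
    moreover have "(norm (u n - u m))\<^sup>2 = 4 - (norm (u n + u m))\<^sup>2"
      using parallelogram[of "u n" "u m"] u(2) by simp
    ultimately show ?thesis
      using parallelogram[of "A (u n)" "A (u m)"] by (simp add: power_mult_distrib right_diff_distrib)
  qed
  have "Cauchy u"
  proof (rule metric_CauchyI)
    fix \<epsilon> :: real assume e: "\<epsilon> > 0"
    \<comment> \<open>The bound \<open>key\<close> is below \<open>2 * d + 2 * d + d\<close>, hence
      the 5.\<close>
    define d where "d = M\<^sup>2 * \<epsilon>\<^sup>2 / 5"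
    have d: "d > 0" using M e by (simp add: d_def)
    have "(\<lambda>n. (norm (A (u n)))\<^sup>2) \<longlonglongrightarrow> M\<^sup>2"
      unfolding u_def by (intro tendsto_power lim)
    then obtain N1 where N1: "\<And>n. n \<ge> N1 \<Longrightarrow> dist ((norm (A (u n)))\<^sup>2) (M\<^sup>2) < d"
      using d unfolding LIMSEQ_def by blast
    have "Cauchy (\<lambda>n. A (u n))"
      unfolding u_def using r(2) by (rule LIMSEQ_imp_Cauchy)
    then obtain N2 where N2: "\<And>m n. m \<ge> N2 \<Longrightarrow> n \<ge> N2 \<Longrightarrow> dist (A (u m)) (A (u n)) < sqrt d"
      using d unfolding Cauchy_def by (auto dest!: spec[of _ "sqrt d"])
    have "dist (u m) (u n) < \<epsilon>" if "m \<ge> max N1 N2" "n \<ge> max N1 N2" for m n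
    proof -
      have N1m: "dist ((norm (A (u m)))\<^sup>2) (M\<^sup>2) < d" and N1n: "dist ((norm (A (u n)))\<^sup>2) (M\<^sup>2) < d"
        using N1[of m] N1[of n] that by simp_all
      have "(norm (A (u m) - A (u n)))\<^sup>2 < (sqrt d)\<^sup>2"
        using N2[of m n] that by (intro power_strict_mono) (auto simp: dist_norm)
      then have "(norm (A (u m) - A (u n)))\<^sup>2 < d"
        using d by simp
      then have "M\<^sup>2 * (norm (u m - u n))\<^sup>2 < 5 * d"
        using key[of m n] N1m N1n unfolding dist_real_def abs_less_iff by argo
      then have "M\<^sup>2 * (norm (u m - u n))\<^sup>2 < M\<^sup>2 * \<epsilon>\<^sup>2" by (simp add: d_def)
      then have "(norm (u m - u n))\<^sup>2 < \<epsilon>\<^sup>2"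
        using M by (simp only: mult_less_cancel_left_pos zero_less_power)
      then show ?thesis unfolding dist_norm using e by (simp add: power_less_imp_less_base)
    qed
    then show "\<exists>N. \<forall>m\<ge>N. \<forall>n\<ge>N. dist (u m) (u n) < \<epsilon>" by blast
  qed
  then obtain v where v: "u \<longlonglongrightarrow> v"
    using Cauchy_convergent unfolding convergent_def by blast
  have "norm v = 1"
    using LIMSEQ_unique[OF tendsto_norm[OF v]] u(2) by simp
  moreover have "A v = y"
    using LIMSEQ_unique[OF bounded_clinear_tendsto[OF A v]] r(2) by (simp add: u_def)
  moreover have "cinner v g = 0" if "g \<in> G" for g
  proof -
    have "(\<lambda>n. cinner (u n) g) \<longlonglongrightarrow> cinner v g" by (intro tendsto_cinner v tendsto_const)
    moreover have "cinner (u n) g = 0" for n using u(1)[of n] that by (simp add: V_def)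
    ultimately show ?thesis by (simp add: LIMSEQ_const_iff)
  qed
  moreover have "A v \<noteq> 0" using \<open>A v = y\<close> My M by auto
  moreover have "norm (A x) \<le> norm (A v) * norm x" if "\<forall>g\<in>G. cinner x g = 0" for x
    using le[of x] that \<open>A v = y\<close> My by (simp add: V_def)
  ultimately show ?thesis by blast
qed

section \<open>Orthonormal systems padded by zeros, and Bessel's inequality\<close>

text \<open>The zero vectors pad the sequence when an operator has finite rank.\<close>

locale orthonormal_or_zero =
  fixes e :: "nat \<Rightarrow> 'h::complex_hilbert_space"
  assumes ortho: "i \<noteq> j \<Longrightarrow> cinner (e i) (e j) = 0"
    and unit: "e i = 0 \<or> norm (e i) = 1"
begin

lemma cinner_e_absorb: "cinner x (e i) * cinner (e i) (e i) = cinner x (e i)"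
  using unit[of i] by (auto simp: cinner_self)

lemma cinner_sum_e:
  assumes "finite I"
  shows "cinner (\<Sum>i\<in>I. c i *\<^sub>C e i) (e j) = (if j \<in> I then c j * cinner (e j) (e j) else 0)"
proof -
  have "cinner (\<Sum>i\<in>I. c i *\<^sub>C e i) (e j) = (\<Sum>i\<in>I. if i = j then c j * cinner (e j) (e j) else 0)"
    unfolding cinner_sum_left by (intro sum.cong) (auto simp: cinner_scaleC_left ortho)
  then show ?thesis using assms by simp
qed

lemma norm_sum_e:
  assumes "finite I"
  shows "(norm (\<Sum>i\<in>I. c i *\<^sub>C e i))\<^sup>2 = (\<Sum>i\<in>I. (cmod (c i) * norm (e i))\<^sup>2)"
proof -
  let ?s = "\<Sum>i\<in>I. c i *\<^sub>C e i"
  have "complex_of_real ((norm ?s)\<^sup>2) = (\<Sum>i\<in>I. cnj (c i) * cinner ?s (e i))"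
    unfolding cinner_self[symmetric] cinner_sum_right cinner_scaleC_right ..
  also have "\<dots> = (\<Sum>i\<in>I. complex_of_real ((cmod (c i) * norm (e i))\<^sup>2))"
  proof (intro sum.cong refl)
    fix i assume "i \<in> I"
    then have "cnj (c i) * cinner ?s (e i) = (c i * cnj (c i)) * cinner (e i) (e i)"
      using assms by (simp add: cinner_sum_e)
    then show "cnj (c i) * cinner ?s (e i) = complex_of_real ((cmod (c i) * norm (e i))\<^sup>2)"
      by (simp only: cinner_self complex_norm_square[symmetric] power_mult_distrib of_real_mult of_real_power)
  qed
  finally show ?thesis by (simp only: of_real_sum[symmetric] of_real_eq_iff)
qed

lemma norm_sum_e_le:
  assumes "finite I"
  shows "(norm (\<Sum>i\<in>I. c i *\<^sub>C e i))\<^sup>2 \<le> (\<Sum>i\<in>I. (cmod (c i))\<^sup>2)"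
  unfolding norm_sum_e[OF assms]
proof (rule sum_mono)
  fix i
  show "(cmod (c i) * norm (e i))\<^sup>2 \<le> (cmod (c i))\<^sup>2"
    using unit[of i] by (auto simp: power_mult_distrib)
qed

definition remainder :: "nat \<Rightarrow> 'h \<Rightarrow> 'h" where
  "remainder n x = x - (\<Sum>k<n. cinner x (e k) *\<^sub>C e k)"

lemma cinner_remainder: "k < n \<Longrightarrow> cinner (remainder n x) (e k) = 0"
  using cinner_sum_e[of "{..<n}" "\<lambda>k. cinner x (e k)" k]
  by (simp add: remainder_def cinner_diff_left cinner_e_absorb)

lemma norm_sq_remainder:
  "(norm x)\<^sup>2 = (norm (remainder n x))\<^sup>2 + (\<Sum>k<n. (cmod (cinner x (e k)))\<^sup>2)"
proof -
  let ?s = "\<Sum>k<n. cinner x (e k) *\<^sub>C e k"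
  have "cinner (remainder n x) ?s = 0"
    by (simp add: cinner_sum_right cinner_scaleC_right cinner_remainder)
  then have "(norm (remainder n x + ?s))\<^sup>2 = (norm (remainder n x))\<^sup>2 + (norm ?s)\<^sup>2"
    by (simp add: norm_add_sq)
  moreover have "(norm ?s)\<^sup>2 = (\<Sum>k<n. (cmod (cinner x (e k)))\<^sup>2)"
    unfolding norm_sum_e[OF finite_lessThan]
  proof (intro sum.cong refl)
    fix k show "(cmod (cinner x (e k)) * norm (e k))\<^sup>2 = (cmod (cinner x (e k)))\<^sup>2"
      using unit[of k] by auto
  qed
  ultimately show ?thesis by (simp add: remainder_def)
qed

lemma Bessel: "(\<Sum>k<n. (cmod (cinner x (e k)))\<^sup>2) \<le> (norm x)\<^sup>2"
  using norm_sq_remainder[of x n] by simp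

lemma norm_remainder_le: "norm (remainder n x) \<le> norm x"
proof (rule power2_le_imp_le)
  have "(\<Sum>k<n. (cmod (cinner x (e k)))\<^sup>2) \<ge> 0" by (intro sum_nonneg) simp
  then show "(norm (remainder n x))\<^sup>2 \<le> (norm x)\<^sup>2"
    using norm_sq_remainder[of x n] by linarith
qed simp

lemma summable_Bessel: "summable (\<lambda>k. (cmod (cinner x (e k)))\<^sup>2)"
  by (rule summableI_nonneg_bounded[OF _ Bessel]) simp

end

section \<open>Diagonal operators between two orthonormal systems\<close>

definition diag_term ::
    "(nat \<Rightarrow> real) \<Rightarrow> (nat \<Rightarrow> 'h) \<Rightarrow> (nat \<Rightarrow> 'h) \<Rightarrow> 'h \<Rightarrow> nat \<Rightarrow> 'h::complex_hilbert_space" where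
  "diag_term c e g x k = (complex_of_real (c k) * cinner x (e k)) *\<^sub>C g k"

text \<open>The systems \<open>e\<close> and \<open>g\<close> are kept apart because the absolute
  value uses one system twice, while the phase maps one system to another.\<close>

definition diag_op ::
    "(nat \<Rightarrow> real) \<Rightarrow> (nat \<Rightarrow> 'h) \<Rightarrow> (nat \<Rightarrow> 'h) \<Rightarrow> 'h \<Rightarrow> 'h::complex_hilbert_space" where
  "diag_op c e g x = (\<Sum>k. diag_term c e g x k)"

text \<open>Pythagoras in the system \<open>g\<close> bounds every finite block of the series by the
  matching block of Bessel's series. Tails then give the Cauchy criterion, and initial segments give
  the norm bound.\<close>

lemma
  assumes "orthonormal_or_zero e" "orthonormal_or_zero g" and c: "\<And>k. \<bar>c k\<bar> \<le> K"
  shows diag_op_sums: "diag_term c e g x sums diag_op c e g x"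
    and diag_op_norm: "norm (diag_op c e g x) \<le> K * norm x"
    and diag_op_bounded: "bounded_clinear (diag_op c e g)"
proof -
  interpret e: orthonormal_or_zero e by fact
  interpret g: orthonormal_or_zero g by fact
  have K0: "K \<ge> 0" using c[of 0] by linarith
  have block: "(norm (\<Sum>k\<in>I. diag_term c e g x k))\<^sup>2 \<le> K\<^sup>2 * (\<Sum>k\<in>I. (cmod (cinner x (e k)))\<^sup>2)"
    if "finite I" for I x
  proof -
    have "(norm (\<Sum>k\<in>I. diag_term c e g x k))\<^sup>2 \<le> (\<Sum>k\<in>I. (cmod (complex_of_real (c k) * cinner x (e k)))\<^sup>2)"
      unfolding diag_term_def by (rule g.norm_sum_e_le[OF that])
    also have "\<dots> \<le> (\<Sum>k\<in>I. K\<^sup>2 * (cmod (cinner x (e k)))\<^sup>2)"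
    proof (rule sum_mono)
      fix k
      have "(c k)\<^sup>2 \<le> K\<^sup>2" using power_mono[OF c[of k], of 2] by simp
      then show "(cmod (complex_of_real (c k) * cinner x (e k)))\<^sup>2 \<le> K\<^sup>2 * (cmod (cinner x (e k)))\<^sup>2"
        by (simp add: norm_mult power_mult_distrib mult_right_mono)
    qed
    finally show ?thesis by (simp add: sum_distrib_left)
  qed
  have summ: "summable (diag_term c e g x)" for x
    unfolding summable_Cauchy
  proof (intro allI impI)
    fix \<epsilon> :: real assume e: "\<epsilon> > 0"
    \<comment> \<open>The added 1 covers the case \<open>K = 0\<close>.\<close>
    then have "\<epsilon>\<^sup>2 / (K\<^sup>2 + 1) > 0" by (simp add: add_nonneg_pos)
    then obtain N where N: "\<And>m n. m \<ge> N \<Longrightarrow> norm (\<Sum>k=m..<n. (cmod (cinner x (e k)))\<^sup>2) < \<epsilon>\<^sup>2 / (K\<^sup>2 + 1)"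
      using e.summable_Bessel[of x] unfolding summable_Cauchy by blast
    have "norm (\<Sum>k=m..<n. diag_term c e g x k) < \<epsilon>" if "m \<ge> N" for m n
    proof (rule power2_less_imp_less)
      let ?b = "\<Sum>k=m..<n. (cmod (cinner x (e k)))\<^sup>2"
      have b0: "?b \<ge> 0" by (intro sum_nonneg) simp
      have "(norm (\<Sum>k=m..<n. diag_term c e g x k))\<^sup>2 \<le> K\<^sup>2 * ?b"
        by (rule block) simp
      also have "\<dots> \<le> (K\<^sup>2 + 1) * ?b" using b0 by (intro mult_right_mono) auto
      also have "\<dots> < (K\<^sup>2 + 1) * (\<epsilon>\<^sup>2 / (K\<^sup>2 + 1))"
        using N[OF that, of n] b0 by (intro mult_strict_left_mono) (auto simp: add_nonneg_pos)
      also have "\<dots> = \<epsilon>\<^sup>2" by (simp add: add_nonneg_eq_0_iff)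
      finally show "(norm (\<Sum>k=m..<n. diag_term c e g x k))\<^sup>2 < \<epsilon>\<^sup>2" .
    qed (use e in simp)
    then show "\<exists>N. \<forall>m\<ge>N. \<forall>n. norm (\<Sum>k=m..<n. diag_term c e g x k) < \<epsilon>" by blast
  qed
  show sums: "diag_term c e g x sums diag_op c e g x" for x
    unfolding diag_op_def using summ by (rule summable_sums)
  show nrm: "norm (diag_op c e g x) \<le> K * norm x" for x
  proof (rule LIMSEQ_le_const2)
    show "(\<lambda>n. norm (\<Sum>k<n. diag_term c e g x k)) \<longlonglongrightarrow> norm (diag_op c e g x)"
      using sums unfolding sums_def by (rule tendsto_norm)
    have "norm (\<Sum>k<n. diag_term c e g x k) \<le> K * norm x" for n
    proof (rule power2_le_imp_le)
      show "(norm (\<Sum>k<n. diag_term c e g x k))\<^sup>2 \<le> (K * norm x)\<^sup>2"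
        using block[of "{..<n}" x] mult_left_mono[OF e.Bessel[where n = n], of "K\<^sup>2" x]
        by (simp add: power_mult_distrib)
    qed (use K0 in simp)
    then show "\<exists>N. \<forall>n\<ge>N. norm (\<Sum>k<n. diag_term c e g x k) \<le> K * norm x" by blast
  qed
  show "bounded_clinear (diag_op c e g)"
  proof (rule bounded_clinearI[OF _ _ nrm])
    show "diag_op c e g (x + y) = diag_op c e g x + diag_op c e g y" for x y
    proof -
      have "diag_term c e g (x + y) = (\<lambda>k. diag_term c e g x k + diag_term c e g y k)"
        by (auto simp: diag_term_def cinner_add_left scaleC_add_left distrib_left)
      then show ?thesis
        using sums_unique2[OF sums[of "x + y"]] sums_add[OF sums[of x] sums[of y]] by simp
    qed
    show "diag_op c e g (a *\<^sub>C x) = a *\<^sub>C diag_op c e g x" for a x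
    proof -
      have "diag_term c e g (a *\<^sub>C x) = (\<lambda>k. a *\<^sub>C diag_term c e g x k)"
        by (auto simp: diag_term_def cinner_scaleC_left scaleC_scaleC mult_ac)
      moreover have "(\<lambda>k. a *\<^sub>C diag_term c e g x k) sums (a *\<^sub>C diag_op c e g x)"
        using bounded_linear.sums[OF bounded_bilinear.bounded_linear_right[OF bounded_bilinear_scaleC] sums] .
      ultimately show ?thesis
        using sums_unique2[OF sums[of "a *\<^sub>C x"]] by simp
    qed
  qed
qed

text \<open>The condition \<open>eigen\<close> is the weak form of A* A e_k = \<mu>_k^2 e_k and
  avoids the adjoint, while \<open>maximal\<close> is the variational description of \<mu>_k.
  Indices beyond the rank have \<open>\<mu> k = 0\<close> and \<open>e k = 0\<close>.\<close>

locale singular_system =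
  fixes A :: "'h::complex_hilbert_space \<Rightarrow> 'h" and e :: "nat \<Rightarrow> 'h" and \<mu> :: "nat \<Rightarrow> real"
  assumes bounded: "bounded_clinear A"
    and norm_e: "\<mu> k \<noteq> 0 \<Longrightarrow> norm (e k) = 1"
    and e_zero: "\<mu> k = 0 \<Longrightarrow> e k = 0"
    and e_ortho: "i \<noteq> j \<Longrightarrow> cinner (e i) (e j) = 0"
    and decseq: "decseq \<mu>"
    and nonneg: "0 \<le> \<mu> k"
    and tendsto_0: "\<mu> \<longlonglongrightarrow> 0"
    and eigen: "cinner (A (e k)) (A x) = complex_of_real ((\<mu> k)\<^sup>2) * cinner (e k) x"
    and maximal: "(\<And>j. j < k \<Longrightarrow> cinner x (e j) = 0) \<Longrightarrow> norm (A x) \<le> \<mu> k * norm x"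

sublocale singular_system \<subseteq> orthonormal_or_zero e
  by unfold_locales (use e_ortho norm_e e_zero in auto)

section \<open>Existence of singular systems by successive maximisation\<close>

lemma real_quadratic_nonneg_imp_linear_zero:
  assumes "\<And>t::real. 0 \<le> 2 * t * a + t\<^sup>2 * b"
  shows "a = 0"
proof (rule ccontr)
  assume "a \<noteq> 0"
  \<comment> \<open>Near 0 the linear term dominates. As \<open>B\<close> exceeds the modulus of
    \<open>b\<close>, the point \<open>t = - a / B\<close> is close enough to 0 to make the
    polynomial negative.\<close>
  define B where "B = \<bar>b\<bar> + 1"
  have B: "B > 0" "b - 2 * B < 0" by (auto simp: B_def)
  have "2 * (- a / B) * a + (- a / B)\<^sup>2 * b = (a\<^sup>2 / B\<^sup>2) * (b - 2 * B)"
    using B(1) by (simp add: field_simps power2_eq_square)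
  also have "\<dots> < 0"
    using \<open>a \<noteq> 0\<close> B by (intro mult_pos_neg) auto
  finally show False using assms[of "- a / B"] by linarith
qed

text \<open>First variation: the difference of the squared sides of \<open>max\<close> at
  \<open>v + t x\<close> is nonnegative and vanishes at \<open>t = 0\<close>, so its derivative
  there is 0. This yields the real parts; the direction \<open>\<i> *\<^sub>C x\<close> yields the
  imaginary parts.\<close>

lemma maximiser_stationary:
  assumes A: "bounded_clinear A" and v: "norm v = 1" "\<forall>g\<in>G. cinner v g = 0"
    and max: "\<And>x. \<forall>g\<in>G. cinner x g = 0 \<Longrightarrow> norm (A x) \<le> norm (A v) * norm x"
    and x: "\<forall>g\<in>G. cinner x g = 0"
  shows "cinner (A v) (A x) = complex_of_real ((norm (A v))\<^sup>2) * cinner v x"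
proof -
  have re: "Re (cinner (A v) (A x)) = (norm (A v))\<^sup>2 * Re (cinner v x)" if "\<forall>g\<in>G. cinner x g = 0" for x
  proof -
    have "0 \<le> 2 * t * ((norm (A v))\<^sup>2 * Re (cinner v x) - Re (cinner (A v) (A x)))
        + t\<^sup>2 * ((norm (A v))\<^sup>2 * (norm x)\<^sup>2 - (norm (A x))\<^sup>2)" for t :: real
    proof -
      let ?y = "complex_of_real t *\<^sub>C x"
      have "norm (A (v + ?y)) \<le> norm (A v) * norm (v + ?y)"
        using that v(2) by (intro max) (simp add: cinner_add_left cinner_scaleC_left)
      then have "(norm (A (v + ?y)))\<^sup>2 \<le> (norm (A v) * norm (v + ?y))\<^sup>2"
        by (intro power_mono) auto
      then have "(norm (A v + A ?y))\<^sup>2 \<le> (norm (A v))\<^sup>2 * (norm (v + ?y))\<^sup>2"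
        by (simp add: bounded_clinearD[OF A] power_mult_distrib)
      then show ?thesis
        unfolding norm_add_sq v(1)
        by (simp add: bounded_clinearD[OF A] cinner_scaleC_right norm_scaleC power_mult_distrib algebra_simps)
    qed
    then show ?thesis
      using real_quadratic_nonneg_imp_linear_zero by fastforce
  qed
  have "\<forall>g\<in>G. cinner (\<i> *\<^sub>C x) g = 0" using x by (simp add: cinner_scaleC_left)
  from re[OF x] re[OF this] show ?thesis
    by (simp add: complex_eq_iff bounded_clinearD[OF A] cinner_scaleC_right)
qed

theorem compact_singular_system:
  assumes A: "bounded_clinear A" and cm: "compact_map A"
  shows "\<exists>e \<mu>. singular_system A e \<mu>"
proof -
  define P where "P G v \<longleftrightarrow> (norm v = 1 \<and> A v \<noteq> 0 \<or> v = 0) \<and> (\<forall>g\<in>G. cinner v g = 0) \<and>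
           (\<forall>x. (\<forall>g\<in>G. cinner x g = 0) \<longrightarrow> norm (A x) \<le> norm (A v) * norm x)" for G v
  define pick where "pick G = (SOME v. P G v)" for G
  \<comment> \<open>The recursion runs over the sets of vectors already picked, since each choice
    depends on all earlier ones.\<close>
  define G where "G = rec_nat {} (\<lambda>_ H. insert (pick H) H)"
  define e where "e n = pick (G n)" for n
  define \<mu> where "\<mu> n = norm (A (e n))" for n
  have G: "G n = e ` {..<n}" for n
  proof (induction n)
    case (Suc n)
    have "G (Suc n) = insert (e n) (G n)" by (simp add: G_def e_def)
    then show ?case using Suc by (simp add: lessThan_Suc)
  qed (simp add: G_def)
  have P: "P (e ` {..<n}) (e n)" for n
  proof -
    have "\<exists>v. P (G n) v" unfolding P_def by (rule compact_map_maximiser[OF A cm])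
    then show ?thesis unfolding G[symmetric] e_def pick_def by (rule someI_ex)
  qed
  have e01: "norm (e n) = 1 \<and> A (e n) \<noteq> 0 \<or> e n = 0" for n
    using P[of n] by (simp add: P_def)
  have ortho_less: "cinner (e n) (e j) = 0" if "j < n" for n j
    using P[of n] that by (simp add: P_def)
  have ortho: "cinner (e i) (e j) = 0" if "i \<noteq> j" for i j
    using that
  proof (cases "i < j")
    case True
    show ?thesis by (subst cinner_commute) (simp add: ortho_less[OF True])
  qed (simp add: ortho_less)
  interpret orthonormal_or_zero e
    by unfold_locales (use ortho e01 in blast)+
  have max: "norm (A x) \<le> \<mu> k * norm x" if "\<And>j. j < k \<Longrightarrow> cinner x (e j) = 0" for k x
    using P[of k] that by (simp add: P_def \<mu>_def)
  have dec: "decseq \<mu>"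
  proof (rule decseq_SucI)
    fix n
    have "\<mu> (Suc n) \<le> \<mu> n * norm (e (Suc n))"
      unfolding \<mu>_def[of "Suc n"] by (rule max) (simp add: ortho_less)
    also have "\<dots> \<le> \<mu> n" using e01[of "Suc n"] by (auto simp: \<mu>_def)
    finally show "\<mu> (Suc n) \<le> \<mu> n" .
  qed
  \<comment> \<open>Stationarity gives the equation only for \<open>x\<close> orthogonal to the
    earlier vectors. On their span both sides vanish, because the induction hypothesis at
    \<open>j < k\<close>, applied to \<open>e k\<close>, makes \<open>A (e j)\<close> orthogonal to
    \<open>A (e k)\<close>.\<close>
  have eig: "cinner (A (e k)) (A x) = complex_of_real ((\<mu> k)\<^sup>2) * cinner (e k) x" for k x
  proof (induction k arbitrary: x rule: less_induct)
    case (less k)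
    show ?case
    proof (cases "e k = 0")
      case False
      define s where "s = (\<Sum>j<k. cinner x (e j) *\<^sub>C e j)"
      have x: "x = remainder k x + s" by (simp add: remainder_def s_def)
      have *: "cinner (A (e k)) (A (remainder k x)) = complex_of_real ((norm (A (e k)))\<^sup>2) * cinner (e k) (remainder k x)"
      proof (rule maximiser_stationary[OF A, of _ "e ` {..<k}"])
        show "norm (e k) = 1" using e01[of k] False by blast
      qed (use P[of k] cinner_remainder in \<open>auto simp: P_def\<close>)
      have "cinner (A (e k)) (A (e j)) = 0" if "j < k" for j
        using less.IH[OF that, of "e k"] that
        by (subst cinner_commute) (simp add: ortho)
      then have "cinner (A (e k)) (A s) = 0"
        by (simp add: s_def bounded_clinearD[OF A] cinner_sum_right cinner_scaleC_right)
      moreover have "cinner (e k) s = 0"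
        by (simp add: s_def cinner_sum_right cinner_scaleC_right ortho)
      ultimately show ?thesis
        using * by (subst (1 2) x) (simp add: bounded_clinearD[OF A] cinner_add_right \<mu>_def)
    qed (simp add: bounded_clinearD[OF A])
  qed
  have lim: "\<mu> \<longlonglongrightarrow> 0"
  \<comment> \<open>The images \<open>A (e n)\<close> are mutually orthogonal with norms
    \<open>\<mu> n\<close>. Two distinct ones can be close only if both are small, so a convergent
    subsequence of images forces small values, and monotonicity extends this to all later
    indices.\<close>
  proof -
    have "norm (e n) \<le> 1" for n using e01[of n] by auto
    then obtain r where r: "strict_mono r" "convergent (\<lambda>n. A (e (r n)))"
      using cm[unfolded compact_map_def, rule_format, of e] by blast
    have diff: "(norm (A (e i) - A (e j)))\<^sup>2 = (\<mu> i)\<^sup>2 + (\<mu> j)\<^sup>2" if "i \<noteq> j" for i j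
      using that by (simp add: norm_diff_sq eig ortho \<mu>_def)
    have "\<exists>N. \<forall>n\<ge>N. \<mu> n < \<epsilon>" if "\<epsilon> > 0" for \<epsilon> :: real
    proof -
      obtain N where N: "\<And>m n. m \<ge> N \<Longrightarrow> n \<ge> N \<Longrightarrow> dist (A (e (r m))) (A (e (r n))) < \<epsilon>"
        using metric_CauchyD[OF convergent_Cauchy[OF r(2)] \<open>\<epsilon> > 0\<close>] by blast
      have "r N \<noteq> r (Suc N)" using strict_mono_eq[OF r(1)] by simp
      then have "(\<mu> (r N))\<^sup>2 + (\<mu> (r (Suc N)))\<^sup>2 < \<epsilon>\<^sup>2"
        using power_strict_mono[OF N[of N "Suc N"], of 2] by (simp add: dist_norm diff)
      then have "(\<mu> (r N))\<^sup>2 < \<epsilon>\<^sup>2"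
        using zero_le_power2[of "\<mu> (r (Suc N))"] by linarith
      then have "\<mu> (r N) < \<epsilon>"
        using that by (simp add: power_less_imp_less_base)
      then show ?thesis
        using dec unfolding decseq_def by (meson le_less_trans)
    qed
    then show ?thesis
      unfolding LIMSEQ_def by (simp add: \<mu>_def)
  qed
  have "singular_system A e \<mu>"
  proof
    show "norm (e k) = 1" if "\<mu> k \<noteq> 0" for k
      using that e01[of k] by (auto simp: \<mu>_def bounded_clinearD[OF A])
    show "e k = 0" if "\<mu> k = 0" for k
      using that e01[of k] by (auto simp: \<mu>_def)
    show "0 \<le> \<mu> k" for k by (simp add: \<mu>_def)
  qed (fact A ortho dec lim eig max)+
  then show ?thesis by blast
qed

text \<open>Since (s + m)(s - m) v = 0, the vector (s - m) v satisfies s w = - m w, which positivity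
  of \<open>s\<close> excludes unless w = 0.\<close>

lemma positive_sqrt_eigenvector:
  assumes s: "bounded_clinear s" and pos: "\<And>x. cinner (s x) x \<in> \<real>\<^sub>\<ge>\<^sub>0"
    and v: "s (s v) = complex_of_real (m\<^sup>2) *\<^sub>C v" and m: "m > 0"
  shows "s v = complex_of_real m *\<^sub>C v"
proof -
  define w where "w = s v - complex_of_real m *\<^sub>C v"
  have "s w = - (complex_of_real m *\<^sub>C w)"
    by (simp add: w_def bounded_clinearD[OF s] v cvec.scale_right_diff_distrib scaleC_scaleC power2_eq_square)
  then have "cinner (s w) w = - complex_of_real (m * (norm w)\<^sup>2)"
    by (simp add: cinner_minus_left cinner_scaleC_left cinner_self)
  then have "m * (norm w)\<^sup>2 \<le> 0"
    using pos[of w] by (simp add: complex_nonneg_Reals_iff)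
  then have "w = 0" using m by (simp add: mult_le_0_iff)
  then show ?thesis by (simp add: w_def)
qed

section \<open>The absolute value of a compact operator\<close>

context singular_system
begin

lemma tendsto_A_remainder: "(\<lambda>n. A (remainder n x)) \<longlonglongrightarrow> 0"
proof (rule Lim_null_comparison[OF always_eventually[OF allI]])
  show "(\<lambda>n. \<mu> n * norm x) \<longlonglongrightarrow> 0"
    using tendsto_0 by (rule tendsto_mult_left_zero)
  show "norm (A (remainder n x)) \<le> \<mu> n * norm x" for n
  proof -
    have "norm (A (remainder n x)) \<le> \<mu> n * norm (remainder n x)"
      by (intro maximal cinner_remainder)
    also have "\<dots> \<le> \<mu> n * norm x" by (intro mult_left_mono norm_remainder_le nonneg)
    finally show ?thesis .
  qed
qed

text \<open>The remainders of \<open>x\<close> need not tend to 0, as the vectors \<open>e k\<close>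
  miss the kernel of \<open>A\<close>. Their images under \<open>A\<close> do tend to 0, and so do
  those under any \<open>L\<close> dominated by \<open>A\<close>.\<close>

lemma expansion:
  assumes L: "bounded_clinear L" and le: "\<And>x. norm (L x) \<le> K * norm (A x)"
  shows "(\<lambda>k. cinner x (e k) *\<^sub>C L (e k)) sums L x"
proof -
  have "(\<lambda>n. L (remainder n x)) \<longlonglongrightarrow> 0"
    by (rule Lim_null_comparison[OF always_eventually tendsto_mult_right_zero[OF tendsto_norm_zero[OF tendsto_A_remainder]]])
      (use le in blast)
  then have "(\<lambda>n. L x - L (remainder n x)) \<longlonglongrightarrow> L x - 0"
    by (intro tendsto_diff tendsto_const)
  then show ?thesis
    by (simp add: sums_def remainder_def bounded_clinearD[OF L])
qed

text \<open>A map dominated by \<open>A\<close> is determined by its values on the system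
  \<open>e\<close>. Both the uniqueness of the square root and the commutation with it are reduced
  to eigenvectors in this way.\<close>

lemma dominated_eqI:
  assumes "bounded_clinear L" "\<And>x. norm (L x) \<le> K * norm (A x)"
    and "bounded_clinear L'" "\<And>x. norm (L' x) \<le> K' * norm (A x)"
    and "\<And>k. L (e k) = L' (e k)"
  shows "L x = L' x"
  using sums_unique2[OF expansion[OF assms(1,2), of x]] expansion[OF assms(3,4), of x] assms(5)
  by simp

lemma abs_mu_le: "\<bar>\<mu> k\<bar> \<le> \<mu> 0"
  using decseq nonneg[of k] by (simp add: decseq_def)

definition abs_map :: "'h \<Rightarrow> 'h" where
  "abs_map = diag_op \<mu> e e"

lemma bounded_abs_map: "bounded_clinear abs_map"
  unfolding abs_map_def by (rule diag_op_bounded[OF orthonormal_or_zero_axioms orthonormal_or_zero_axioms abs_mu_le])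

lemma abs_map_sums: "diag_term \<mu> e e x sums abs_map x"
  unfolding abs_map_def by (rule diag_op_sums[OF orthonormal_or_zero_axioms orthonormal_or_zero_axioms abs_mu_le])

lemma abs_map_e: "abs_map (e k) = complex_of_real (\<mu> k) *\<^sub>C e k"
proof -
  have "diag_term \<mu> e e (e k) = (\<lambda>j. if j = k then complex_of_real (\<mu> k) *\<^sub>C e k else 0)"
    using unit[of k] by (auto simp: diag_term_def ortho cinner_self fun_eq_iff)
  then show ?thesis
    using sums_unique2[OF abs_map_sums[of "e k"]] sums_single[of k "\<lambda>_. complex_of_real (\<mu> k) *\<^sub>C e k"] by simp
qed

lemma cinner_abs_map_sums:
  "(\<lambda>k. complex_of_real (\<mu> k) * cinner x (e k) * cinner (e k) y) sums cinner (abs_map x) y"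
  using bounded_linear.sums[OF bounded_bilinear.bounded_linear_left[OF bounded_bilinear_cinner] abs_map_sums, of x y]
  by (simp add: diag_term_def cinner_scaleC_left)

lemma abs_map_symmetric: "cinner (abs_map x) y = cinner x (abs_map y)"
proof -
  have "(\<lambda>k. cnj (complex_of_real (\<mu> k) * cinner y (e k) * cinner (e k) x)) sums cnj (cinner (abs_map y) x)"
    by (intro bounded_linear.sums[OF bounded_linear_cnj] cinner_abs_map_sums)
  moreover have "cnj (complex_of_real (\<mu> k) * cinner y (e k) * cinner (e k) x)
      = complex_of_real (\<mu> k) * cinner x (e k) * cinner (e k) y" for k
    by (simp flip: cinner_commute)
  ultimately have "cinner (abs_map x) y = cnj (cinner (abs_map y) x)"
    using sums_unique2[OF cinner_abs_map_sums[of x y]] by (simp only:)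
  then show ?thesis by (simp flip: cinner_commute)
qed

lemma abs_map_nonneg: "cinner (abs_map x) x \<in> \<real>\<^sub>\<ge>\<^sub>0"
proof (rule closed_sequentially[OF closed_nonneg_Reals_complex])
  show "(\<lambda>n. \<Sum>k<n. complex_of_real (\<mu> k) * cinner x (e k) * cinner (e k) x) \<longlonglongrightarrow> cinner (abs_map x) x"
    using cinner_abs_map_sums by (simp add: sums_def)
  have "complex_of_real (\<mu> k) * cinner x (e k) * cinner (e k) x = complex_of_real (\<mu> k * (cmod (cinner x (e k)))\<^sup>2)" for k
    unfolding of_real_mult complex_norm_square cinner_commute[of "e k" x] by simp
  then show "(\<Sum>k<n. complex_of_real (\<mu> k) * cinner x (e k) * cinner (e k) x) \<in> \<real>\<^sub>\<ge>\<^sub>0" for n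
    by (simp only: of_real_sum[symmetric] nonneg_Reals_of_real_iff) (intro sum_nonneg mult_nonneg_nonneg nonneg zero_le_power2)
qed

text \<open>This is the weak form of |A|^2 = A* A. Expanding \<open>x\<close> along the system
  reduces it to \<open>x = e k\<close>, where \<open>eigen\<close> applies.\<close>

lemma cinner_abs_map: "cinner (abs_map w) (abs_map x) = cinner (A w) (A x)"
proof -
  have A_e: "cinner (A w) (A (e k)) = complex_of_real ((\<mu> k)\<^sup>2) * cinner w (e k)" for k
    using eigen[of k w] cinner_commute[of "A w" "A (e k)"] cinner_commute[of w "e k"] by simp
  have q_e: "cinner (abs_map w) (e k) = complex_of_real (\<mu> k) * cinner w (e k)" for k
    by (simp add: abs_map_symmetric abs_map_e cinner_scaleC_right)
  have "(\<lambda>k. cinner (A w) (cinner x (e k) *\<^sub>C A (e k))) sums cinner (A w) (A x)"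
    by (intro bounded_linear.sums[OF bounded_bilinear.bounded_linear_right[OF bounded_bilinear_cinner]]
        expansion[OF bounded, of 1]) simp
  moreover have "(\<lambda>k. cinner (abs_map w) (diag_term \<mu> e e x k)) sums cinner (abs_map w) (abs_map x)"
    by (intro bounded_linear.sums[OF bounded_bilinear.bounded_linear_right[OF bounded_bilinear_cinner]] abs_map_sums)
  ultimately show ?thesis
    using sums_unique2 by (simp add: diag_term_def cinner_scaleC_right A_e q_e power2_eq_square mult_ac)
qed

lemma norm_abs_map: "norm (abs_map x) = norm (A x)"
proof -
  have "complex_of_real ((norm (abs_map x))\<^sup>2) = complex_of_real ((norm (A x))\<^sup>2)"
    unfolding cinner_self[symmetric] by (rule cinner_abs_map)
  then show ?thesis by (simp add: power2_eq_iff_nonneg del: of_real_power)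
qed

lemma adjoint_comp_self: "op_comp (op_adjoint (op_graph A)) (op_graph A) = op_graph (\<lambda>x. abs_map (abs_map x))"
proof -
  have "(\<forall>w. cinner (A w) (A x) = cinner w z) \<longleftrightarrow> z = abs_map (abs_map x)" for x z
    using cinner_ext_right[of z "abs_map (abs_map x)"]
    by (auto simp: cinner_abs_map[symmetric] abs_map_symmetric)
  then show ?thesis
    by (auto simp: op_comp_def op_adjoint_def op_graph_def relcomp_unfold)
qed

end

section \<open>Everywhere defined operators as graphs\<close>

lemma Domain_op_graph [simp]: "Domain (op_graph f) = UNIV"
  by (auto simp: op_graph_def)

lemma Range_op_graph [simp]: "Range (op_graph f) = range f"
  by (auto simp: op_graph_def)

lemma op_diff_op_graph: "op_diff (op_graph f) (op_graph g) = op_graph (\<lambda>x. f x - g x)"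
  by (auto simp: op_diff_def op_graph_def)

lemma op_comp_op_graph: "op_comp (op_graph f) (op_graph g) = op_graph (\<lambda>x. f (g x))"
  by (auto simp: op_comp_def op_graph_def)

lemma self_adjoint_op_graph:
  assumes f: "bounded_clinear f" and sym: "\<And>x y. cinner (f x) y = cinner x (f y)"
  shows "self_adjoint (op_graph f)"
proof -
  have "(\<forall>w. cinner (f w) y = cinner w z) \<longleftrightarrow> z = f y" for y z
    using cinner_ext_right[of z "f y"] by (auto simp: sym)
  then have "op_adjoint (op_graph f) = op_graph f"
    by (auto simp: op_adjoint_def op_graph_def)
  moreover have "linear_operator (op_graph f)"
    by (auto simp: linear_operator_def op_graph_def single_valued_def bounded_clinearD[OF f])
  moreover have "Domain (op_graph f) = UNIV" by (auto simp: op_graph_def)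
  ultimately show ?thesis by (simp add: self_adjoint_def)
qed

section \<open>Uniqueness of the positive square root, and its commutant\<close>

context singular_system
begin

lemma positive_abs_map: "positive_op (op_graph abs_map)"
  unfolding positive_op_def
  using self_adjoint_op_graph[OF bounded_abs_map abs_map_symmetric] abs_map_nonneg
  by (auto simp: op_graph_def)

text \<open>The competitor \<open>S\<close> may a priori be unbounded and only partially defined.
  Its square is everywhere defined, hence so is \<open>S\<close>; symmetry gives it the same norms
  as \<open>A\<close>, hence boundedness and domination. It then remains to compare values on the
  eigenvectors \<open>e k\<close>.\<close>

lemma positive_sqrt_unique:
  assumes S: "positive_op S" and sq: "op_comp S S = op_graph (\<lambda>x. abs_map (abs_map x))"
  shows "S = op_graph abs_map"
proof -
  have lin: "linear_operator S" and adj: "op_adjoint S = S" and pos: "\<And>x y. (x, y) \<in> S \<Longrightarrow> cinner y x \<in> \<real>\<^sub>\<ge>\<^sub>0"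
    using S by (auto simp: positive_op_def self_adjoint_def)
  have sv: "y = z" if "(x, y) \<in> S" "(x, z) \<in> S" for x y z
    using lin that by (auto simp: linear_operator_def single_valued_def)
  have "\<exists>y. (x, y) \<in> S" for x
  proof -
    have "(x, abs_map (abs_map x)) \<in> S O S"
      using sq by (auto simp: op_comp_def op_graph_def)
    then show ?thesis by blast
  qed
  then obtain s where s: "\<And>x. (x, s x) \<in> S" by metis
  have S_s: "S = op_graph s"
    using s sv by (auto simp: op_graph_def)
  have sym: "cinner (s w) x = cinner w (s x)" for w x
  proof -
    have "(x, s x) \<in> op_adjoint S" using s adj by simp
    then have "\<forall>(u, v) \<in> S. cinner v x = cinner u (s x)" by (simp only: op_adjoint_def mem_Collect_eq prod.case)
    then show ?thesis using s[of w] by blast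
  qed
  have ss: "s (s x) = abs_map (abs_map x)" for x
  proof -
    have "(x, s (s x)) \<in> S O S" using s by blast
    then show ?thesis using sq by (auto simp: op_comp_def op_graph_def)
  qed
  have "complex_of_real ((norm (s x))\<^sup>2) = complex_of_real ((norm (A x))\<^sup>2)" for x
    unfolding cinner_self[symmetric] by (simp add: sym ss cinner_abs_map[symmetric] abs_map_symmetric)
  then have nrm: "norm (s x) = norm (A x)" for x
    by (simp add: power2_eq_iff_nonneg del: of_real_power)
  obtain K where K: "\<And>x. norm (A x) \<le> K * norm x"
    using bounded_clinear_bound[OF bounded] by blast
  have bs: "bounded_clinear s"
  proof (rule bounded_clinearI)
    show "s (x + y) = s x + s y" for x y
      using lin s by (intro sv[of "x + y"]) (auto simp: linear_operator_def)
    show "s (c *\<^sub>C x) = c *\<^sub>C s x" for c x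
      using lin s by (intro sv[of "c *\<^sub>C x"]) (auto simp: linear_operator_def)
    show "norm (s x) \<le> K * norm x" for x using nrm K by simp
  qed
  have "s (e k) = abs_map (e k)" for k
  proof (cases "\<mu> k = 0")
    case True
    then show ?thesis by (simp add: e_zero bounded_clinearD[OF bs] bounded_clinearD[OF bounded_abs_map])
  next
    case False
    then have "\<mu> k > 0" using nonneg[of k] by simp
    moreover have "s (s (e k)) = complex_of_real ((\<mu> k)\<^sup>2) *\<^sub>C e k"
      by (simp add: ss abs_map_e bounded_clinearD[OF bounded_abs_map] scaleC_scaleC power2_eq_square)
    ultimately show ?thesis
      using positive_sqrt_eigenvector[OF bs pos[OF s]] by (simp add: abs_map_e)
  qed
  then have "s x = abs_map x" for x
    using dominated_eqI[OF bs _ bounded_abs_map, of 1 1 x] nrm norm_abs_map by simp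
  then have "s = abs_map" by blast
  then show ?thesis using S_s by simp
qed

lemma op_abs_eq: "op_abs (op_graph A) = op_graph abs_map"
  unfolding op_abs_def adjoint_comp_self
proof (rule the_equality)
  show "positive_op (op_graph abs_map)
      \<and> op_comp (op_graph abs_map) (op_graph abs_map) = op_graph (\<lambda>x. abs_map (abs_map x))"
    using positive_abs_map op_comp_op_graph by blast
qed (use positive_sqrt_unique in blast)

text \<open>\<open>L\<close> preserves the eigenspaces of the square of \<open>abs_map\<close>, and
  by positivity these are eigenspaces of \<open>abs_map\<close> itself. The bound \<open>le\<close>
  makes \<open>abs_map\<close> after \<open>L\<close> a dominated map, so that agreement on the
  system \<open>e\<close> suffices.\<close>

lemma abs_map_commute:
  assumes L: "bounded_clinear L" and comm: "\<And>x. L (abs_map (abs_map x)) = abs_map (abs_map (L x))"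
    and le: "\<And>x. norm (A (L x)) \<le> K * norm (A x)"
  shows "L (abs_map x) = abs_map (L x)"
proof -
  obtain M where M: "\<And>x. norm (L x) \<le> M * norm x"
    using bounded_clinear_bound[OF L] by blast
  show ?thesis
  proof (rule dominated_eqI[where L = "\<lambda>x. L (abs_map x)" and L' = "\<lambda>x. abs_map (L x)"])
    show "bounded_clinear (\<lambda>x. L (abs_map x))" "bounded_clinear (\<lambda>x. abs_map (L x))"
      using bounded_clinear_compose[OF L bounded_abs_map] bounded_clinear_compose[OF bounded_abs_map L] .
    show "norm (L (abs_map x)) \<le> M * norm (A x)" for x
      using M[of "abs_map x"] by (simp add: norm_abs_map)
    show "norm (abs_map (L x)) \<le> K * norm (A x)" for x
      using le by (simp add: norm_abs_map)
    fix k
    show "L (abs_map (e k)) = abs_map (L (e k))"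
    proof (cases "\<mu> k = 0")
      case True
      then show ?thesis by (simp add: e_zero bounded_clinearD[OF L] bounded_clinearD[OF bounded_abs_map])
    next
      case False
      then have "\<mu> k > 0" using nonneg[of k] by simp
      moreover have "abs_map (abs_map (L (e k))) = complex_of_real ((\<mu> k)\<^sup>2) *\<^sub>C L (e k)"
        by (simp add: comm[symmetric] abs_map_e bounded_clinearD[OF L] bounded_clinearD[OF bounded_abs_map]
            scaleC_scaleC power2_eq_square)
      ultimately show ?thesis
        using positive_sqrt_eigenvector[OF bounded_abs_map abs_map_nonneg]
        by (simp add: abs_map_e bounded_clinearD[OF L])
    qed
  qed
qed

section \<open>Multiplicities of singular values\<close>

lemma finite_level: "s > 0 \<Longrightarrow> finite {k. \<mu> k = s}"
proof -
  assume "s > 0"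
  then have "eventually (\<lambda>k. \<mu> k < s) sequentially"
    using order_tendstoD(2)[OF tendsto_0] by blast
  then obtain N where "\<And>k. k \<ge> N \<Longrightarrow> \<mu> k < s"
    by (auto simp: eventually_sequentially)
  then have "{k. \<mu> k = s} \<subseteq> {..<N}"
    by (force simp: not_le[symmetric])
  then show ?thesis using finite_subset by blast
qed

text \<open>The vectors \<open>e k\<close> with \<open>\<mu> k = s\<close> form a basis of the
  eigenspace. For spanning, symmetry makes an eigenvector orthogonal to every other
  \<open>e k\<close>, so the series for \<open>abs_map x\<close>, which is \<open>s\<close> times
  \<open>x\<close>, reduces to a finite sum.\<close>

lemma card_level:
  assumes s: "s > 0"
  shows "card {k. \<mu> k = s} = vector_space.dim (*\<^sub>C) (eigenspace (op_graph abs_map) s)"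
proof -
  define K where "K = {k. \<mu> k = s}"
  have K: "finite K" using finite_level[OF s] by (simp add: K_def)
  have e1: "cinner (e k) (e k) = 1" if "k \<in> K" for k
    using norm_e[of k] that s by (simp add: K_def cinner_self)
  have inj: "inj_on e K"
    using e1 ortho by (intro inj_onI) (metis zero_neq_one)
  have es: "eigenspace (op_graph abs_map) s = {x. abs_map x = complex_of_real s *\<^sub>C x}"
    by (auto simp: eigenspace_def op_graph_def)
  have "cvec.dim (eigenspace (op_graph abs_map) s) = card (e ` K)"
  proof (rule cvec.dim_unique[OF _ _ _ refl])
    show "e ` K \<subseteq> eigenspace (op_graph abs_map) s"
      by (auto simp: es K_def abs_map_e)
    show "cvec.independent (e ` K)"
    proof (rule cvec.independent_if_scalars_zero)
      fix f x assume sum0: "(\<Sum>x\<in>e ` K. f x *\<^sub>C x) = 0" and "x \<in> e ` K"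
      then obtain j where j: "j \<in> K" "x = e j" by blast
      have "0 = cinner (\<Sum>k\<in>K. f (e k) *\<^sub>C e k) (e j)"
        using sum0 by (simp add: sum.reindex[OF inj])
      also have "\<dots> = f x" using j K by (simp add: cinner_sum_e[OF K, of "\<lambda>k. f (e k)"] e1)
      finally show "f x = 0" by simp
    qed (use K in simp)
    show "eigenspace (op_graph abs_map) s \<subseteq> cvec.span (e ` K)"
    proof
      fix x assume "x \<in> eigenspace (op_graph abs_map) s"
      then have x: "abs_map x = complex_of_real s *\<^sub>C x" by (simp add: es)
      have "cinner x (e k) = 0" if "k \<notin> K" for k
      proof -
        have "complex_of_real s * cinner x (e k) = complex_of_real (\<mu> k) * cinner x (e k)"
          using abs_map_symmetric[of x "e k"] by (simp add: x abs_map_e cinner_scaleC_left cinner_scaleC_right)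
        then show ?thesis using that by (auto simp: K_def)
      qed
      then have "diag_term \<mu> e e x k = 0" if "k \<notin> K" for k
        using that by (simp add: diag_term_def)
      then have "diag_term \<mu> e e x sums (\<Sum>k\<in>K. diag_term \<mu> e e x k)"
        using K by (intro sums_finite) auto
      then have "complex_of_real s *\<^sub>C x = (\<Sum>k\<in>K. diag_term \<mu> e e x k)"
        using sums_unique2[OF abs_map_sums[of x]] x by simp
      moreover have "diag_term \<mu> e e x k \<in> cvec.span (e ` K)" if "k \<in> K" for k
        unfolding diag_term_def using that by (intro cvec.span_scale cvec.span_base) auto
      ultimately have "complex_of_real s *\<^sub>C x \<in> cvec.span (e ` K)"
        by (simp add: cvec.span_sum)
      then have "complex_of_real (inverse s) *\<^sub>C complex_of_real s *\<^sub>C x \<in> cvec.span (e ` K)"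
        by (rule cvec.span_scale)
      then show "x \<in> cvec.span (e ` K)"
        using s by (simp add: scaleC_scaleC scaleC_one flip: of_real_mult)
    qed
  qed
  also have "\<dots> = card K" by (rule card_image[OF inj])
  finally show ?thesis by (simp add: K_def)
qed

lemma singular_values: "singular_values (op_graph A) \<mu>"
  unfolding singular_values_def op_abs_eq
  using decseq nonneg finite_level card_level by blast

end

section \<open>Comparison of singular values by the min-max argument\<close>

lemma homogeneous_system_nontrivial_solution:
  fixes a :: "'i \<Rightarrow> 'j \<Rightarrow> 'k::field"
  assumes "finite J" "finite I" "card J < card I"
  shows "\<exists>c. (\<exists>i\<in>I. c i \<noteq> 0) \<and> (\<forall>j\<in>J. (\<Sum>i\<in>I. c i * a i j) = 0)"
  using assms
proof (induction J arbitrary: I a rule: finite_induct)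
  case empty
  then have "I \<noteq> {}" by auto
  then show ?case by (intro exI[of _ "\<lambda>_. 1"]) auto
next
  case (insert j J)
  show ?case
  proof (cases "\<forall>i\<in>I. a i j = 0")
    case True
    have "card J < card I" using insert by simp
    from insert.IH[OF insert.prems(1) this] True show ?thesis by fastforce
  next
    case False
    then obtain p where p: "p \<in> I" "a p j \<noteq> 0" by blast
    \<comment> \<open>Gaussian elimination: equation \<open>j\<close> is solved for the unknown with
      pivot index \<open>p\<close>, and the result is substituted into the other equations.\<close>
    define a' where "a' i l = a i l - a i j / a p j * a p l" for i l
    have "card J < card (I - {p})" "finite (I - {p})"
      using insert p by auto
    from insert.IH[OF this(2,1), of a'] obtain c
      where c: "\<exists>i\<in>I - {p}. c i \<noteq> 0" "\<forall>l\<in>J. (\<Sum>i\<in>I - {p}. c i * a' i l) = 0"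
      by blast
    \<comment> \<open>Back substitution for the pivot unknown.\<close>
    define d where "d = c(p := - (\<Sum>i\<in>I - {p}. c i * a i j) / a p j)"
    have d: "(\<Sum>i\<in>I. d i * a i l) = (\<Sum>i\<in>I - {p}. c i * a' i l)" for l
    proof -
      have "(\<Sum>i\<in>I. d i * a i l) = d p * a p l + (\<Sum>i\<in>I - {p}. d i * a i l)"
        using insert.prems(1) p(1) by (rule sum.remove)
      also have "(\<Sum>i\<in>I - {p}. d i * a i l) = (\<Sum>i\<in>I - {p}. c i * a i l)"
        by (intro sum.cong) (auto simp: d_def)
      also have "d p * a p l = - (\<Sum>i\<in>I - {p}. c i * (a i j / a p j * a p l))"
        by (simp add: d_def sum_distrib_left sum_distrib_right sum_divide_distrib mult_ac)
      also have "\<dots> + (\<Sum>i\<in>I - {p}. c i * a i l) = (\<Sum>i\<in>I - {p}. c i * a' i l)"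
        by (simp add: a'_def right_diff_distrib sum_subtractf)
      finally show ?thesis .
    qed
    have "(\<Sum>i\<in>I. d i * a i j) = 0"
      unfolding d using p(2) by (simp add: a'_def)
    moreover have "\<exists>i\<in>I. d i \<noteq> 0" using c(1) by (auto simp: d_def)
    ultimately show ?thesis using c(2) d by (intro exI[of _ d]) simp
  qed
qed

text \<open>A nonzero \<open>x\<close> in the span of the first \<open>k + 1\<close> vectors
  \<open>e i\<close> can be chosen orthogonal to the first \<open>k\<close> vectors
  \<open>f j\<close>. Then \<open>norm (A x)\<close> is at least \<open>\<mu> k * norm x\<close>,
  and at most \<open>M * \<nu> k * norm x\<close> by maximality for \<open>T\<close>.\<close>

lemma singular_value_le:
  assumes A: "singular_system A e \<mu>" and T: "singular_system T f \<nu>"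
    and le: "\<And>x. norm (A x) \<le> M * norm (T x)" and M: "M \<ge> 0"
  shows "\<mu> k \<le> M * \<nu> k"
\<comment> \<open>If \<open>\<mu> k = 0\<close> then \<open>e k = 0\<close>, and the span would be
  too small for the dimension count.\<close>
proof (cases "\<mu> k = 0")
  case True
  then show ?thesis using M singular_system.nonneg[OF T] by simp
next
  case False
  interpret A: singular_system A e \<mu> by fact
  interpret T: singular_system T f \<nu> by fact
  have mu: "\<mu> k > 0" using False A.nonneg[of k] by simp
  have mono: "\<mu> k \<le> \<mu> i" if "i \<le> k" for i
    using A.decseq that by (simp add: decseq_def)
  have e1: "cinner (e i) (e i) = 1" "norm (e i) = 1" if "i \<le> k" for i
    using A.norm_e[of i] mono[OF that] mu by (auto simp: cinner_self)
  obtain c where c: "\<exists>i\<in>{..k}. c i \<noteq> 0" "\<forall>j\<in>{..<k}. (\<Sum>i\<le>k. c i * cinner (e i) (f j)) = 0"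
    using homogeneous_system_nontrivial_solution[of "{..<k}" "{..k}" "\<lambda>i j. cinner (e i) (f j)"] by auto
  define x where "x = (\<Sum>i\<le>k. c i *\<^sub>C e i)"
  have "norm (T x) \<le> \<nu> k * norm x"
    using c(2) by (intro T.maximal) (simp add: x_def cinner_sum_left cinner_scaleC_left)
  then have up: "norm (A x) \<le> M * \<nu> k * norm x"
    using le[of x] M by (smt (verit) mult.assoc mult_left_mono)
  have nx: "(norm x)\<^sup>2 = (\<Sum>i\<le>k. (cmod (c i))\<^sup>2)"
    unfolding x_def A.norm_sum_e[OF finite_atMost] by (intro sum.cong) (auto simp: e1)
  have "cinner (e i) x = cnj (c i)" if "i \<le> k" for i
    using A.cinner_sum_e[of "{..k}" c i] that by (subst cinner_commute) (simp add: x_def e1)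
  moreover have "cinner (A x) (A x) = (\<Sum>i\<le>k. c i * cinner (A (e i)) (A x))"
    by (subst (1) x_def) (simp add: bounded_clinearD[OF A.bounded] cinner_sum_left cinner_scaleC_left)
  ultimately have "cinner (A x) (A x) = (\<Sum>i\<le>k. complex_of_real ((\<mu> i)\<^sup>2 * (cmod (c i))\<^sup>2))"
    unfolding of_real_mult complex_norm_square by (simp add: A.eigen mult_ac)
  then have "(norm (A x))\<^sup>2 = (\<Sum>i\<le>k. (\<mu> i)\<^sup>2 * (cmod (c i))\<^sup>2)"
    unfolding cinner_self of_real_sum[symmetric] of_real_eq_iff .
  also have "\<dots> \<ge> (\<Sum>i\<le>k. (\<mu> k)\<^sup>2 * (cmod (c i))\<^sup>2)"
    using mono mu by (intro sum_mono mult_right_mono power_mono) auto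
  finally have "(\<mu> k * norm x)\<^sup>2 \<le> (norm (A x))\<^sup>2"
    by (simp add: power_mult_distrib nx sum_distrib_left)
  then have "\<mu> k * norm x \<le> norm (A x)"
    by (rule power2_le_imp_le) simp
  with up have "\<mu> k * norm x \<le> M * \<nu> k * norm x" by linarith
  moreover have "norm x > 0"
  proof -
    obtain i where "i \<le> k" "c i \<noteq> 0" using c(1) by auto
    then have "(\<Sum>i\<le>k. (cmod (c i))\<^sup>2) > 0"
      by (intro sum_pos2[of _ i]) auto
    then have "(norm x)\<^sup>2 > 0" by (simp only: nx)
    then show ?thesis by simp
  qed
  ultimately show ?thesis by simp
qed

section \<open>Summability of singular values\<close>

text \<open>A summability hypothesis supplies some sequence of singular values, not the one of a
  chosen singular system. Equal multiplicities give a bijection between the positive entries of the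
  two, and sums of nonnegative terms are invariant under rearrangement.\<close>

lemma summable_singular_values_transfer:
  assumes mu: "singular_values S \<mu>" and nu: "singular_values S \<nu>"
    and sum: "summable (\<lambda>k. \<nu> k powr p)"
  shows "summable (\<lambda>k. \<mu> k powr p)"
proof -
  have pos: "0 \<le> \<mu> k" "0 \<le> \<nu> k" for k
    using mu nu by (auto simp: singular_values_def)
  \<comment> \<open>The bijection is assembled level by level, from finite level sets of equal
    cardinality.\<close>
  have "\<exists>h. bij_betw h {k. \<nu> k = s} {k. \<mu> k = s}" if "s > 0" for s
    using mu nu that by (intro finite_same_card_bij) (auto simp: singular_values_def)
  then obtain h where h: "\<And>s. s > 0 \<Longrightarrow> bij_betw (h s) {k. \<nu> k = s} {k. \<mu> k = s}"
    by metis
  define f where "f k = h (\<nu> k) k" for k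
  have mu_f: "\<mu> (f k) = \<nu> k" if "\<nu> k > 0" for k
    using bij_betwE[OF h[OF that]] by (auto simp: f_def)
  have bij: "bij_betw f {k. \<nu> k > 0} {k. \<mu> k > 0}"
  proof (rule bij_betw_imageI)
    show "inj_on f {k. \<nu> k > 0}"
    proof (rule inj_onI)
      fix i j assume ij: "i \<in> {k. \<nu> k > 0}" "j \<in> {k. \<nu> k > 0}" "f i = f j"
      then have "\<nu> i = \<nu> j" using mu_f[of i] mu_f[of j] by simp
      then show "i = j"
        using ij bij_betw_imp_inj_on[OF h, of "\<nu> i"] by (auto simp: f_def inj_on_def)
    qed
    show "f ` {k. \<nu> k > 0} = {k. \<mu> k > 0}"
    proof
      show "f ` {k. \<nu> k > 0} \<subseteq> {k. \<mu> k > 0}" using mu_f by auto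
      show "{k. \<mu> k > 0} \<subseteq> f ` {k. \<nu> k > 0}"
      proof
        fix m assume "m \<in> {k. \<mu> k > 0}"
        then have m: "\<mu> m > 0" by simp
        then have "m \<in> h (\<mu> m) ` {k. \<nu> k = \<mu> m}"
          using bij_betw_imp_surj_on[OF h[OF m]] by simp
        then obtain k where k: "\<nu> k = \<mu> m" "m = h (\<mu> m) k" by blast
        then have "m = f k" by (simp add: f_def)
        then show "m \<in> f ` {k. \<nu> k > 0}" using k(1) m by (intro image_eqI) auto
      qed
    qed
  qed
  \<comment> \<open>As \<open>0 powr p = 0\<close>, the zero entries, which the bijection leaves
    unmatched, contribute nothing.\<close>
  have restrict: "(\<lambda>k. \<xi> k powr p) summable_on {k. \<xi> k > 0} \<longleftrightarrow> summable (\<lambda>k. \<xi> k powr p)"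
    if "\<And>k. 0 \<le> \<xi> k" for \<xi> :: "nat \<Rightarrow> real"
  proof -
    have "(\<lambda>k. \<xi> k powr p) summable_on {k. \<xi> k > 0} \<longleftrightarrow> (\<lambda>k. \<xi> k powr p) summable_on UNIV"
      using that by (intro summable_on_cong_neutral) (auto simp: less_le)
    then show ?thesis by (simp add: summable_on_UNIV_nonneg_real_iff)
  qed
  have "(\<lambda>k. \<mu> (f k) powr p) summable_on {k. \<nu> k > 0}
      \<longleftrightarrow> (\<lambda>k. \<nu> k powr p) summable_on {k. \<nu> k > 0}"
    by (rule summable_on_cong) (simp add: mu_f)
  then have "(\<lambda>k. \<mu> (f k) powr p) summable_on {k. \<nu> k > 0}"
    using sum restrict[of \<nu>, OF pos(2)] by simp
  then show ?thesis
    using summable_on_reindex_bij_betw[OF bij, of "\<lambda>k. \<mu> k powr p"] restrict[of \<mu>, OF pos(1)] by simp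
qed

text \<open>The exponent \<open>2 * m\<close> turns the bound into a multiple of k^(-2).\<close>

lemma bigo_powr_imp_summable:
  assumes "\<nu> \<in> O(\<lambda>k. real k powr (- 1 / m))" and "m > 0" and nonneg: "\<And>k. 0 \<le> \<nu> k"
  shows "summable (\<lambda>k. \<nu> k powr (2 * m))"
proof -
  obtain c where c: "c > 0" "eventually (\<lambda>k. norm (\<nu> k) \<le> c * norm (real k powr (- 1 / m))) sequentially"
    using landau_o.bigE[OF assms(1)] by blast
  have "summable (\<lambda>k. c powr (2 * m) * real k powr (-2))"
    by (intro summable_mult) (simp add: summable_real_powr_iff)
  then show ?thesis
  proof (rule summable_comparison_test_ev[rotated])
    show "eventually (\<lambda>k. norm (\<nu> k powr (2 * m)) \<le> c powr (2 * m) * real k powr (-2)) sequentially"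
      using c(2)
    proof eventually_elim
      case (elim k)
      have "\<nu> k powr (2 * m) \<le> (c * real k powr (- 1 / m)) powr (2 * m)"
        using elim nonneg[of k] \<open>m > 0\<close> by (intro powr_mono2) auto
      also have "\<dots> = c powr (2 * m) * real k powr (-2)"
        using c(1) \<open>m > 0\<close> by (simp add: powr_mult powr_powr)
      finally show ?case by simp
    qed
  qed
qed

text \<open>By monotonicity \<open>N * \<nu> N\<close> is at most the partial sum, hence O(log N)
  and so O(N^(1/2)). The weak ideal for n = 1 is thereby reduced to the decay condition for n =
  2.\<close>

lemma bigo_ln_partial_sums_imp_bigo_powr:
  assumes "(\<lambda>N. \<Sum>k\<le>N. \<nu> k) \<in> O(\<lambda>N. ln (real N))" and dec: "decseq \<nu>" and nonneg: "\<And>k. 0 \<le> \<nu> k"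
  shows "\<nu> \<in> O(\<lambda>k. real k powr (- 1 / 2))"
proof -
  obtain c where c: "c > 0" "eventually (\<lambda>N. norm (\<Sum>k\<le>N. \<nu> k) \<le> c * norm (ln (real N))) sequentially"
    using landau_o.bigE[OF assms(1)] by blast
  have "eventually (\<lambda>k. norm (\<nu> k) \<le> 2 * c * norm (real k powr (- 1 / 2))) sequentially"
    using c(2) eventually_gt_at_top[of 0]
  proof eventually_elim
    case (elim N)
    have "real N * \<nu> N \<le> real (card {..N}) * \<nu> N"
      using nonneg[of N] by (intro mult_right_mono) auto
    also have "\<dots> \<le> (\<Sum>k\<le>N. \<nu> k)"
      using dec by (intro sum_bounded_below) (auto simp: decseq_def)
    also have "\<dots> \<le> c * ln (real N)"
      using elim by simp
    \<comment> \<open>The bound ln x \<le> x^a / a at a = 1/2 produces the factor 2 in the constant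
      \<open>2 * c\<close>.\<close>
    also have "\<dots> \<le> c * (real N powr (1 / 2) / (1 / 2))"
      using c(1) elim by (intro mult_left_mono ln_powr_bound) auto
    finally have "\<nu> N \<le> 2 * c * (real N powr (1 / 2) / real N)"
      using elim by (simp add: field_simps)
    also have "real N powr (1 / 2) / real N = real N powr (- 1 / 2)"
      using elim powr_diff[of "real N" "1 / 2" 1] by simp
    finally show ?case using nonneg[of N] by simp
  qed
  then show ?thesis by (rule landau_o.bigI[rotated]) (use c(1) in simp)
qed

lemma in_weak_schatten_summable:
  assumes "in_weak_schatten n S" "n \<ge> 1"
  obtains \<nu> p where "singular_values S \<nu>" "p \<ge> 1" "summable (\<lambda>k. \<nu> k powr p)"
proof -
  obtain \<nu> where nu: "singular_values S \<nu>"
    and O: "if n = 1 then (\<lambda>N. \<Sum>k\<le>N. \<nu> k) \<in> O(\<lambda>N. ln (real N))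
         else \<nu> \<in> O(\<lambda>k. real k powr (- 1 / real n))"
    using assms(1) unfolding in_weak_schatten_def by blast
  have dec: "decseq \<nu>" and nonneg: "\<And>k. 0 \<le> \<nu> k"
    using nu by (auto simp: singular_values_def)
  define m where "m = (if n = 1 then 2 else real n)"
  have "\<nu> \<in> O(\<lambda>k. real k powr (- 1 / m))"
    using O bigo_ln_partial_sums_imp_bigo_powr[OF _ dec nonneg] by (auto simp: m_def split: if_splits)
  moreover have "m \<ge> 1" using assms(2) by (simp add: m_def)
  ultimately have "summable (\<lambda>k. \<nu> k powr (2 * m))"
    using nonneg by (intro bigo_powr_imp_summable) auto
  then show ?thesis using nu \<open>m \<ge> 1\<close> by (intro that[of \<nu> "2 * m"]) auto
qed

text \<open>The given \<open>\<nu>\<close> is first exchanged for the values of a singular system of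
  \<open>T\<close>, because \<open>singular_value_le\<close> compares singular systems.\<close>

lemma in_schatten_dominated:
  assumes T: "bounded_clinear T" "compact_map T" and nu: "singular_values (op_graph T) \<nu>"
    and sum: "summable (\<lambda>k. \<nu> k powr p)" and p: "p \<ge> 1"
    and A: "bounded_clinear A" and le: "\<And>x. norm (A x) \<le> M * norm (T x)" and M: "M \<ge> 0"
  shows "in_schatten p (op_graph A)"
proof -
  have cA: "compact_map A" by (rule compact_map_dominated[OF T(2) A T(1) le])
  obtain e \<mu> where t: "singular_system T e \<mu>"
    using compact_singular_system[OF T] by blast
  obtain e' \<mu>' where a: "singular_system A e' \<mu>'"
    using compact_singular_system[OF A cA] by blast
  have "summable (\<lambda>k. \<mu> k powr p)"
    by (rule summable_singular_values_transfer[OF singular_system.singular_values[OF t] nu sum])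
  then have "summable (\<lambda>k. M powr p * \<mu> k powr p)" by (rule summable_mult)
  then have "summable (\<lambda>k. \<mu>' k powr p)"
  proof (rule summable_comparison_test[rotated], intro exI allI impI)
    fix k
    have "\<mu>' k powr p \<le> (M * \<mu> k) powr p"
      using singular_value_le[OF a t le M] singular_system.nonneg[OF a] p by (intro powr_mono2) auto
    then show "norm (\<mu>' k powr p) \<le> M powr p * \<mu> k powr p"
      using M singular_system.nonneg[OF t] by (simp add: powr_mult)
  qed
  then show ?thesis
    using A cA singular_system.singular_values[OF a] unfolding in_schatten_def compact_op_iff by blast
qed

section \<open>The phase of an operator with compact inverse\<close>

locale injective_symmetric_singular_system = singular_system T e \<mu>
  for T :: "'h::complex_hilbert_space \<Rightarrow> 'h" and e \<mu> +
  assumes symmetric: "cinner (T x) y = cinner x (T y)"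
    and injective: "T x = T y \<Longrightarrow> x = y"
begin

lemma T_T: "T (T x) = abs_map (abs_map x)"
  by (rule cinner_ext_right) (metis symmetric abs_map_symmetric cinner_abs_map)

lemma abs_map_eq_0: "abs_map x = 0 \<Longrightarrow> x = 0"
  using norm_abs_map[of x] injective[of x 0] by (simp add: bounded_clinearD[OF bounded])

text \<open>\<open>T\<close> commutes with its own square, which is the square of
  \<open>abs_map\<close>.\<close>

lemma T_abs_map: "T (abs_map x) = abs_map (T x)"
proof -
  obtain K where "\<And>x. norm (T x) \<le> K * norm x"
    using bounded_clinear_bound[OF bounded] by blast
  then show ?thesis
    by (rule abs_map_commute[OF bounded, of K, rotated]) (simp_all add: T_T[symmetric])
qed

text \<open>This is D |D|^(-1) written through T = D^(-1): as T^2 e_k = \<mu>_k^2 e_k, applying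
  T^(-1) |T| to e_k gives \<mu>_k T^(-1) e_k = \<mu>_k^(-1) T e_k. Where \<open>\<mu> k = 0\<close>,
  both \<open>e k\<close> and \<open>inverse (\<mu> k)\<close> are 0.\<close>

definition phase :: "'h \<Rightarrow> 'h" where
  "phase = diag_op (\<lambda>_. 1) e (\<lambda>k. complex_of_real (inverse (\<mu> k)) *\<^sub>C T (e k))"

lemma orthonormal_or_zero_image: "orthonormal_or_zero (\<lambda>k. complex_of_real (inverse (\<mu> k)) *\<^sub>C T (e k))"
proof
  fix i
  have "norm (T (e i)) = \<mu> i * norm (e i)"
    using norm_abs_map[of "e i"] nonneg[of i] by (simp add: abs_map_e norm_scaleC)
  then show "complex_of_real (inverse (\<mu> i)) *\<^sub>C T (e i) = 0
      \<or> norm (complex_of_real (inverse (\<mu> i)) *\<^sub>C T (e i)) = 1"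
    using norm_e[of i] e_zero[of i] nonneg[of i]
    by (cases "\<mu> i = 0") (auto simp: norm_scaleC norm_inverse bounded_clinearD[OF bounded])
qed (simp add: cinner_scaleC_left cinner_scaleC_right eigen ortho)

lemma norm_phase_le: "norm (phase x) \<le> norm x"
  using diag_op_norm[OF orthonormal_or_zero_axioms orthonormal_or_zero_image, of "\<lambda>_. 1" 1 x]
  by (simp add: phase_def)

lemma bounded_phase: "bounded_clinear phase"
  unfolding phase_def
  by (rule diag_op_bounded[OF orthonormal_or_zero_axioms orthonormal_or_zero_image, of _ 1]) simp

lemma T_phase: "T (phase x) = abs_map x"
proof -
  let ?g = "\<lambda>k. complex_of_real (inverse (\<mu> k)) *\<^sub>C T (e k)"
  have "(\<lambda>k. T (diag_term (\<lambda>_. 1) e ?g x k)) sums T (phase x)"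
    unfolding phase_def
    by (intro bounded_linear.sums[OF bounded_clinearD(1)[OF bounded]]
        diag_op_sums[OF orthonormal_or_zero_axioms orthonormal_or_zero_image, of _ 1]) simp
  moreover have "T (diag_term (\<lambda>_. 1) e ?g x k) = diag_term \<mu> e e x k" for k
    by (cases "\<mu> k = 0")
      (simp_all add: diag_term_def bounded_clinearD[OF bounded] e_zero T_T abs_map_e
        bounded_clinearD[OF bounded_abs_map] scaleC_scaleC field_simps)
  ultimately show ?thesis using sums_unique2[OF abs_map_sums] by simp
qed

lemma abs_map_phase: "abs_map (phase x) = T x"
  by (rule injective) (simp add: T_abs_map T_phase T_T)

lemma phase_phase: "phase (phase x) = x"
  by (rule injective) (simp add: T_phase abs_map_phase)

lemma norm_phase: "norm (phase x) = norm x"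
  using norm_phase_le[of x] norm_phase_le[of "phase x"] by (simp add: phase_phase)

text \<open>An isometry that is its own inverse is symmetric.\<close>

lemma phase_symmetric: "cinner (phase x) y = cinner x (phase y)"
  using cinner_isometry[OF bounded_phase norm_phase, of x "phase y"] by (simp add: phase_phase)

text \<open>The hypotheses express D a - a' D = b and |D| a - a' |D| = b' on the common domain,
  multiplied by the inverses. Taking the first at \<open>phase y\<close>, where
  \<open>T (phase y) = abs_map y\<close>, gives a second expression for
  \<open>a (abs_map y)\<close>, and injectivity of \<open>T\<close> allows the two to be
  compared.\<close>

lemma phase_commutator:
  assumes "\<And>y. a (T y) = T (b (T y) + a' y)" "\<And>y. a (abs_map y) = abs_map (b' (abs_map y) + a' y)"
  shows "phase (a' y) - a' (phase y) = b (abs_map y) - phase (b' (abs_map y))"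
proof -
  have "a (abs_map y) = T (b (abs_map y) + a' (phase y))"
    using assms(1)[of "phase y"] by (simp add: T_phase)
  moreover have "abs_map (b' (abs_map y) + a' y) = T (phase (b' (abs_map y)) + phase (a' y))"
    by (simp add: T_phase bounded_clinearD[OF bounded] bounded_clinearD[OF bounded_abs_map])
  ultimately have "b (abs_map y) + a' (phase y) = phase (b' (abs_map y)) + phase (a' y)"
    using assms(2) injective by metis
  then show ?thesis by (simp add: algebra_simps)
qed

lemma phase_anticommute:
  assumes g: "bounded_clinear \<gamma>" and anti: "\<And>y. \<gamma> (T y) = - T (\<gamma> y)"
  shows "phase (\<gamma> x) = - \<gamma> (phase x)"
proof (rule injective)
  obtain K where K: "\<And>x. norm (\<gamma> x) \<le> K * norm x"
    using bounded_clinear_bound[OF g] by blast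
  have "\<gamma> (abs_map y) = abs_map (\<gamma> y)" for y
  proof (rule abs_map_commute[OF g])
    show "norm (T (\<gamma> z)) \<le> K * norm (T z)" for z
      using K[of "T z"] by (simp add: anti)
    show "\<gamma> (abs_map (abs_map z)) = abs_map (abs_map (\<gamma> z))" for z
      by (simp add: T_T[symmetric] anti bounded_clinearD[OF bounded])
  qed
  \<comment> \<open>With F the phase, T F \<gamma> = |T| \<gamma> = \<gamma> |T| = \<gamma> T F = -
    T \<gamma> F.\<close>
  then show "T (phase (\<gamma> x)) = T (- \<gamma> (phase x))"
    using anti[of "phase x"] by (simp add: T_phase bounded_clinearD[OF bounded])
qed

end

section \<open>Absolute value and phase of the unbounded operator\<close>

lemma positive_op_converse:
  assumes S: "positive_op S" and inj: "\<And>x. (x, 0) \<in> S \<Longrightarrow> x = 0" and dense: "closure (Range S) = UNIV"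
  shows "positive_op (S\<inverse>)"
proof -
  have lin: "linear_operator S" and adj: "op_adjoint S = S" and pos: "\<And>x y. (x, y) \<in> S \<Longrightarrow> cinner y x \<in> \<real>\<^sub>\<ge>\<^sub>0"
    using S by (auto simp: positive_op_def self_adjoint_def)
  have add: "(x + x', y + y') \<in> S" if "(x, y) \<in> S" "(x', y') \<in> S" for x x' y y'
    using lin that by (simp add: linear_operator_def)
  have sc: "(c *\<^sub>C x, c *\<^sub>C y) \<in> S" if "(x, y) \<in> S" for c x y
    using lin that by (simp add: linear_operator_def)
  have "x = x'" if "(x, y) \<in> S" "(x', y) \<in> S" for x x' y
  proof -
    have "(x + (- 1) *\<^sub>C x', y + (- 1) *\<^sub>C y) \<in> S" by (intro add sc that)
    then show ?thesis using inj[of "x - x'"] by simp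
  qed
  then have "single_valued (S\<inverse>)" by (auto simp: single_valued_def)
  moreover have "(0, 0) \<in> S" using lin by (simp add: linear_operator_def)
  ultimately have "linear_operator (S\<inverse>)"
    using add sc by (simp add: linear_operator_def)
  moreover have "op_adjoint (S\<inverse>) = S\<inverse>"
  proof -
    \<comment> \<open>Taking converses exchanges the two sides of the equation that defines the
      adjoint graph.\<close>
    have "op_adjoint (S\<inverse>) = (op_adjoint S)\<inverse>"
      by (force simp: op_adjoint_def)
    then show ?thesis by (simp add: adj)
  qed
  moreover have "cinner x y \<in> \<real>\<^sub>\<ge>\<^sub>0" if "(x, y) \<in> S" for x y
    using pos[OF that] by (subst cinner_commute) (simp add: complex_nonneg_Reals_iff)
  ultimately show ?thesis
    using dense by (auto simp: positive_op_def self_adjoint_def)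
qed

locale compact_inverse = injective_symmetric_singular_system T e \<mu>
  for T :: "'h::complex_hilbert_space \<Rightarrow> 'h" and e \<mu> +
  fixes D :: "'h operator"
  assumes self_adjoint: "self_adjoint D" and D_eq: "D = (op_graph T)\<inverse>"
begin

lemma op_comp_converse: "op_comp (S\<inverse>) (R\<inverse>) = (op_comp R S)\<inverse>" for R S :: "'h operator"
  by (auto simp: op_comp_def)

lemma adjoint_comp: "op_comp (op_adjoint D) D = (op_graph (\<lambda>x. abs_map (abs_map x)))\<inverse>"
  using self_adjoint unfolding self_adjoint_def
  by (simp add: D_eq op_comp_converse op_comp_op_graph T_T)

text \<open>A positive square root of D* D is inverted to a positive square root of |T|^2, where
  uniqueness is already known. Conversely, the range of |T| equals that of \<open>T\<close>, the
  domain of \<open>D\<close>, so it is dense and the inverse of |T| is self-adjoint.\<close>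

lemma op_abs_D: "op_abs D = (op_graph abs_map)\<inverse>"
  unfolding op_abs_def adjoint_comp
proof (rule the_equality)
  have "range abs_map = range T"
    by (metis abs_map_phase T_phase image_cong rangeI subset_antisym image_subset_iff)
  then have "Range (op_graph abs_map) = Domain D"
    by (simp add: D_eq)
  then have "positive_op ((op_graph abs_map)\<inverse>)"
    using self_adjoint abs_map_eq_0
    by (intro positive_op_converse[OF positive_abs_map]) (simp_all add: self_adjoint_def, simp add: op_graph_def)
  then show "positive_op ((op_graph abs_map)\<inverse>)
      \<and> op_comp ((op_graph abs_map)\<inverse>) ((op_graph abs_map)\<inverse>) = (op_graph (\<lambda>x. abs_map (abs_map x)))\<inverse>"
    by (simp add: op_comp_converse op_comp_op_graph)
next
  fix S assume S: "positive_op S \<and> op_comp S S = (op_graph (\<lambda>x. abs_map (abs_map x)))\<inverse>"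
  have mem: "(x, z) \<in> S O S \<longleftrightarrow> x = abs_map (abs_map z)" for x z
    using S by (auto simp: op_comp_def op_graph_def)
  have zero: "(0, 0) \<in> S"
    using S by (simp add: positive_op_def self_adjoint_def linear_operator_def)
  have "positive_op (S\<inverse>)"
  proof (rule positive_op_converse)
    \<comment> \<open>Composing with the pair \<open>(0, 0)\<close> puts \<open>(x, 0)\<close> into
      the square of \<open>S\<close>, so \<open>x\<close> is the image of 0 under |T|^2.\<close>
    show "x = 0" if "(x, 0) \<in> S" for x
      using mem[of x 0] relcompI[OF that zero] by (simp add: bounded_clinearD[OF bounded_abs_map])
    have "z \<in> Range S" for z
      using mem[of "abs_map (abs_map z)" z] by blast
    then show "closure (Range S) = UNIV" by (metis UNIV_I UNIV_eq_I closure_UNIV)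
  qed (use S in blast)
  moreover have "op_comp (S\<inverse>) (S\<inverse>) = op_graph (\<lambda>x. abs_map (abs_map x))"
    using S by (simp add: op_comp_converse)
  ultimately have "S\<inverse> = op_graph abs_map" by (rule positive_sqrt_unique)
  then show "S = (op_graph abs_map)\<inverse>" by (metis converse_converse)
qed

lemma phase_eq: "op_comp D ((op_abs D)\<inverse>) = op_graph phase"
proof -
  have "abs_map x = T y \<longleftrightarrow> y = phase x" for x y
    using injective T_phase by metis
  then show ?thesis
    unfolding op_abs_D unfolding D_eq by (auto simp: op_comp_def op_graph_def relcomp_unfold)
qed

end

section \<open>The hypotheses on \<open>D\<close> in terms of bounded operators\<close>

lemma compact_inverseI:
  assumes sa: "self_adjoint D" and res: "compact_resolvent D" and inv: "invertible_op D"
  obtains T e \<mu> where "compact_inverse T e \<mu> D" "compact_map T" "D\<inverse> = op_graph T"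
proof -
  obtain T where T: "bounded_clinear T" "D\<inverse> = op_graph T"
    using inv by (auto simp: invertible_op_def bounded_op_def)
  then have D: "D = (op_graph T)\<inverse>" by (metis converse_converse)
  obtain K where K: "K > 0" "\<And>x. norm (T x) \<le> K * norm x"
    using bounded_clinear_bound[OF T(1)] by blast
  obtain z R where R: "bounded_clinear R" "compact_map R" "(op_shift D z)\<inverse> = op_graph R"
    using res unfolding compact_resolvent_def compact_op_def using compact_map_iff by metis
  \<comment> \<open>This is the resolvent identity between the points 0 and \<open>z\<close>. It
    transfers compactness from the resolvent at \<open>z\<close> to the inverse \<open>T\<close> by
    domination.\<close>
  have "T x = R x - z *\<^sub>C T (R x)" for x
  proof -
    have "(x, R x) \<in> (op_shift D z)\<inverse>" by (simp add: R(3) op_graph_def)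
    then have "R x = T (x + z *\<^sub>C R x)"
      by (auto simp: op_shift_def op_diff_def op_graph_def D)
    then have "R x = T x + z *\<^sub>C T (R x)" by (simp add: bounded_clinearD[OF T(1)])
    then show ?thesis by (metis add_diff_cancel_right')
  qed
  then have "norm (T x) \<le> norm (R x) + norm (z *\<^sub>C T (R x))" for x
    by (metis norm_triangle_ineq4)
  then have "norm (T x) \<le> (1 + cmod z * K) * norm (R x)" for x
    using mult_left_mono[OF K(2)[of "R x"], of "cmod z"]
    by (fastforce simp: norm_scaleC algebra_simps intro: order_trans)
  then have cT: "compact_map T"
    using compact_map_dominated[OF R(2) T(1) R(1)] by blast
  then obtain e \<mu> where sys: "singular_system T e \<mu>"
    using compact_singular_system[OF T(1)] by blast
  have sym: "cinner (T x) y = cinner x (T y)" for x y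
  proof -
    have "(T y, y) \<in> op_adjoint D" and "(T x, x) \<in> D"
      using sa by (auto simp: self_adjoint_def D op_graph_def)
    then show ?thesis by (auto simp: op_adjoint_def)
  qed
  have inj: "x = y" if "T x = T y" for x y
    using inv that by (auto simp: invertible_op_def linear_operator_def single_valued_def D op_graph_def)
  interpret singular_system T e \<mu> by fact
  have "compact_inverse T e \<mu> D"
    by unfold_locales (fact sym inj sa D)+
  then show ?thesis using that cT T(2) by blast
qed

text \<open>Multiplying the commutator relation by the inverse \<open>t\<close> leaves an identity
  between everywhere defined maps. It is applied with \<open>t\<close> equal to \<open>T\<close> for
  \<open>D\<close>, and to \<open>abs_map\<close> for |D|.\<close>

lemma bounded_twisted_commutator_inverse:
  assumes "bounded_twisted_commutators \<sigma> \<pi> ((op_graph t)\<inverse>)"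
  obtains b where "bounded_clinear b" "\<And>y. \<pi> a (t y) = t (b (t y) + \<pi> (\<sigma> a) y)"
proof -
  let ?D = "(op_graph t)\<inverse>"
  obtain B where dom: "\<pi> a ` Domain ?D \<subseteq> Domain ?D"
    and B: "bounded_op B" "twisted_commutator \<sigma> \<pi> ?D a \<subseteq> B"
    using assms[unfolded bounded_twisted_commutators_def, rule_format, of a] by blast
  obtain b where b: "bounded_clinear b" "twisted_commutator \<sigma> \<pi> ?D a \<subseteq> op_graph b"
    using B unfolding bounded_op_def by metis
  have "\<pi> a (t y) = t (b (t y) + \<pi> (\<sigma> a) y)" for y
  proof -
    \<comment> \<open>Invariance of the domain, which is the range of \<open>t\<close>, supplies
      \<open>z\<close> as the value of the unbounded operator at
      \<open>\<pi> a (t y)\<close>.\<close>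
    obtain z where z: "\<pi> a (t y) = t z"
      using dom by (auto simp: image_subset_iff)
    have "(t y, z - \<pi> (\<sigma> a) y) \<in> twisted_commutator \<sigma> \<pi> ?D a"
      using z unfolding twisted_commutator_def op_diff_def op_comp_def op_graph_def by blast
    then have "b (t y) = z - \<pi> (\<sigma> a) y"
      using b(2) by (auto simp: op_graph_def)
    then show ?thesis using z by simp
  qed
  then show ?thesis using b(1) that by blast
qed

theorem proposition3p2:
  fixes \<sigma> :: "'a::complex_algebra \<Rightarrow> 'a"
    and \<pi> :: "'a \<Rightarrow> 'h::complex_hilbert_space \<Rightarrow> 'h"
    and D F :: "'h operator"
  assumes "algebra_automorphism \<sigma>"
    and "spectral_triple \<sigma> \<pi> D"
    and "lipschitz_regular \<sigma> \<pi> D"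
    and "invertible_op D"
    and "F = op_comp D ((op_abs D)\<inverse>)"
  shows "fredholm_module \<pi> F \<and>
    (\<forall>\<gamma>. grading \<pi> D \<gamma> \<longrightarrow> grading \<pi> F \<gamma>) \<and>
    (finitely_summable_triple D \<longrightarrow> finitely_summable_module \<pi> F)"
proof -
  have act: "algebra_action \<pi>" and sa: "self_adjoint D" and res: "compact_resolvent D"
    and btc: "bounded_twisted_commutators \<sigma> \<pi> D"
    using assms(2) by (auto simp: spectral_triple_def)
  have pi: "bounded_clinear (\<pi> a)" for a using act by (simp add: algebra_action_def)
  obtain T e \<mu> where ci: "compact_inverse T e \<mu> D" and cT: "compact_map T" and D_inv: "D\<inverse> = op_graph T"
    using compact_inverseI[OF sa res assms(4)] .
  interpret compact_inverse T e \<mu> D by fact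
  have F: "F = op_graph phase" using assms(5) phase_eq by simp
  define C where "C a = (\<lambda>x. phase (\<pi> a x) - \<pi> a (phase x))" for a
  have comm: "twisted_commutator id \<pi> F a = op_graph (C a)" for a
    by (simp add: F C_def twisted_commutator_def op_comp_op_graph op_diff_op_graph)
  have bC: "bounded_clinear (C a)" for a
    unfolding C_def by (intro bounded_clinear_diff bounded_clinear_compose[OF bounded_phase pi]
        bounded_clinear_compose[OF pi bounded_phase])
  have "\<exists>M\<ge>0. \<forall>x. norm (C c x) \<le> M * norm (T x)" for c
  proof -
    obtain a where a: "c = \<sigma> a"
      using assms(1) unfolding algebra_automorphism_def by (metis bij_pointE)
    obtain b where b: "bounded_clinear b" "\<And>y. \<pi> a (T y) = T (b (T y) + \<pi> (\<sigma> a) y)"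
      using bounded_twisted_commutator_inverse btc unfolding D_eq by metis
    obtain b' where b': "bounded_clinear b'" "\<And>y. \<pi> a (abs_map y) = abs_map (b' (abs_map y) + \<pi> (\<sigma> a) y)"
      using bounded_twisted_commutator_inverse assms(3) unfolding lipschitz_regular_def op_abs_D by metis
    obtain K where K: "K > 0" "\<And>x. norm (b x) \<le> K * norm x"
      using bounded_clinear_bound[OF b(1)] by blast
    obtain K' where K': "K' > 0" "\<And>x. norm (b' x) \<le> K' * norm x"
      using bounded_clinear_bound[OF b'(1)] by blast
    have "norm (C c x) \<le> (K + K') * norm (T x)" for x
    proof -
      have "C c x = b (abs_map x) - phase (b' (abs_map x))"
        unfolding C_def a using b(2) b'(2) by (rule phase_commutator)
      then have "norm (C c x) \<le> norm (b (abs_map x)) + norm (b' (abs_map x))"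
        using norm_triangle_ineq4[of "b (abs_map x)" "phase (b' (abs_map x))"] by (simp add: norm_phase)
      also have "\<dots> \<le> K * norm (abs_map x) + K' * norm (abs_map x)"
        by (intro add_mono K K')
      finally show ?thesis by (simp add: norm_abs_map algebra_simps)
    qed
    then show ?thesis using K(1) K'(1) by (intro exI[of _ "K + K'"]) auto
  qed
  then obtain M where M: "\<And>a. M a \<ge> 0" "\<And>a x. norm (C a x) \<le> M a * norm (T x)"
    by metis
  have "compact_op (twisted_commutator id \<pi> F a)" for a
    unfolding comm compact_op_iff using compact_map_dominated[OF cT bC bounded M(2)] bC by blast
  moreover have "op_comp F F = Id"
    by (simp add: F op_comp_op_graph phase_phase) (auto simp: op_graph_def)
  moreover have "op_adjoint F = F"
    using self_adjoint_op_graph[OF bounded_phase phase_symmetric] by (simp add: F self_adjoint_def)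
  moreover have "bounded_op F" using bounded_phase by (auto simp: F bounded_op_def)
  ultimately have "fredholm_module \<pi> F" using act by (simp add: fredholm_module_def)
  moreover have "grading \<pi> F \<gamma>" if g: "grading \<pi> D \<gamma>" for \<gamma>
  proof -
    have bg: "bounded_clinear \<gamma>" and anti: "op_comp D (op_graph \<gamma>) = op_comp (op_graph (\<lambda>x. - \<gamma> x)) D"
      using g by (auto simp: grading_def)
    have "\<gamma> (T y) = - T (\<gamma> y)" for y
    proof -
      \<comment> \<open>As \<open>D\<close> sends \<open>T y\<close> to \<open>y\<close>,
        anticommutation at \<open>T y\<close> says that \<open>D\<close> sends
        \<open>\<gamma> (T y)\<close> to \<open>- \<gamma> y\<close>; inverting \<open>D\<close>
        gives the claim.\<close>
      have "(T y, - \<gamma> y) \<in> op_comp (op_graph (\<lambda>x. - \<gamma> x)) D"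
        by (auto simp: op_comp_def op_graph_def D_eq)
      then have "(\<gamma> (T y), - \<gamma> y) \<in> D"
        unfolding anti[symmetric] by (auto simp: op_comp_def op_graph_def)
      then show ?thesis by (auto simp: D_eq op_graph_def bounded_clinearD[OF bounded])
    qed
    from phase_anticommute[OF bg this]
    have "op_comp F (op_graph \<gamma>) = op_comp (op_graph (\<lambda>x. - \<gamma> x)) F"
      by (simp add: F op_comp_op_graph)
    then show ?thesis using g by (simp add: grading_def)
  qed
  moreover have "finitely_summable_module \<pi> F" if "finitely_summable_triple D"
  proof -
    obtain n where n: "n \<ge> 1" "in_weak_schatten n (op_graph T)"
      using \<open>finitely_summable_triple D\<close> by (auto simp: finitely_summable_triple_def D_inv)
    obtain \<nu> p where nu: "singular_values (op_graph T) \<nu>" "p \<ge> 1" "summable (\<lambda>k. \<nu> k powr p)"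
      using in_weak_schatten_summable[OF n(2,1)] .
    \<comment> \<open>The exponent \<open>p\<close> comes from \<open>T\<close> alone, and only the
      factor \<open>M a\<close> varies with \<open>a\<close>, so one \<open>p\<close> serves all
      commutators.\<close>
    have "in_schatten p (twisted_commutator id \<pi> F a)" for a
      unfolding comm by (rule in_schatten_dominated[OF bounded cT nu(1,3,2) bC M(2,1)])
    then show ?thesis using nu(2) by (auto simp: finitely_summable_module_def)
  qed
  ultimately show ?thesis by blast
qed

end
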